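(* Let $F$ be a finite field with the discrete topology and let $(\Lambda,\lesssim)$ be an infinite $\mathbb{Z}$-like preordered set. Then $\mathrm{Z}_{\Lambda}(F)$ is the unique largest proper closed normal subgroup of $\mathrm{AU}_{\Lambda}(F)$; that is, $\mathrm{Z}_\Lambda(F)$ is a proper closed normal subgroup and it contains every proper closed normal subgroup of $\mathrm{AU}_\Lambda(F)$. In particular, $\mathrm{AU}_{\Lambda}(F)/\mathrm{Z}_{\Lambda}(F)$ is topologically simple.
   Context: Let $(\Lambda,\lesssim)$ be a preordered set ($\lesssim$ reflexive and transitive). Write $i\sim j$ if $i\lesssim j$ and $j\lesssim i$; $i\lnsim j$ if $i\lesssim j$ and $i\not\sim j$; $[i,j]=\{k\in\Lambda : i\lesssim k\lesssim j\}$. A subset $\Lambda'\subseteq\Lambda$ is convex if $[i,j]\subseteq\Lambda'$ whenever $i,j\in\Lambda'$; it is strongly convex if for every $i\in\Lambda\setminus\Lambda'$ either $i\lnsim j$ for all $j\in\Lambda'$, or $j\lnsim i$ for all $j\in\Lambda'$. $(\Lambda,\lesssim)$ is $\mathbb{Z}$-like if every finite subset of $\Lambda$ is contained in a finite strongly convex subset. A $(\Lambda\times\Lambda)$-matrix over a commutative unital ring $R$ is a tuple $(a_{ij})_{i,j\in\Lambda}$ of elements of $R$; $\mathrm{M}_\Lambda(R)$ is the set of these. The product of $(a_{ij})$ and $(b_{ij})$ is $(\sum_{k}a_{ik}b_{kj})_{i,j}$, defined only when each of these sums has finitely many nonzero terms. The matrix $(a_{ij})$ is nonsingular if there is a finite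 convex $\Lambda'\subseteq\Lambda$ such that $(a_{ij})_{i,j\in\Lambda''}$ is invertible over $R$ for every finite convex $\Lambda''\supseteq\Lambda'$; upper triangular if $a_{ij}=0$ whenever $i\not\lesssim j$; almost upper triangular if $a_{ij}=0$ for all but finitely many pairs $(i,j)$ with $i\not\lesssim j$; scalar if $a_{ij}=0$ for $i\neq j$ and $a_{ii}$ is constant. $\mathrm{U}_\Lambda(R)$, $\mathrm{AU}_\Lambda(R)$ and $\mathrm{Z}_\Lambda(R)$ are the groups (under matrix multiplication) of nonsingular upper triangular, nonsingular almost upper triangular, and nonsingular scalar matrices, respectively. Topology ($R$ discrete): for any $\mathbb{Z}$-like preorder, $\mathrm{U}_\Lambda(R)$ carries the subspace topology from the product topology on $\mathrm{M}_\Lambda(R)=R^{\Lambda\times\Lambda}$. For a finite convex $\Lambda'\subseteq\Lambda$, $\Lambda+\Lambda'$ denotes the set $\Lambda$ with the smallest preorder containing $\lesssim$ and making all elements of $\Lambda'$ equivalent (it is again $\mathbb{Z}$-like). $\mathrm{AU}_\Lambda(R)$ is the union of its subgroups $\mathrm{U}_{\Lambda+\Lambda'}(R)$ and carries the unique group topology for which the inclusion of $\mathrm{U}_{\Lambda+\Lambda'}(R)$ into $\mathrm{AU}_\Lambda(R)$ is continuous and open for every finite convex $\Lambda'\subseteq\Lambda$. A topological group is topologically simple if it is nontrivial and its only closed normal subgroups are the trivial subgroup and the whole group. *)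

theory Defs
  imports
    "HOL-Analysis.Analysis"
    "HOL-Algebra.Coset"
    "HOL-Library.Groups_Big_Fun"
begin

text \<open>
  The preordered set is a type \<open>'i\<close> with an explicit relation \<open>lesim\<close>; that \<open>lesim\<close> is reflexive and
  transitive is always a separate hypothesis.
\<close>

section \<open>Preorders\<close>

definition preord_equiv :: "('i \<Rightarrow> 'i \<Rightarrow> bool) \<Rightarrow> 'i \<Rightarrow> 'i \<Rightarrow> bool" where
  "preord_equiv lesim i j \<longleftrightarrow> lesim i j \<and> lesim j i"

definition preord_less :: "('i \<Rightarrow> 'i \<Rightarrow> bool) \<Rightarrow> 'i \<Rightarrow> 'i \<Rightarrow> bool" where
  "preord_less lesim i j \<longleftrightarrow> lesim i j \<and> \<not> preord_equiv lesim i j"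

definition preord_interval :: "('i \<Rightarrow> 'i \<Rightarrow> bool) \<Rightarrow> 'i \<Rightarrow> 'i \<Rightarrow> 'i set" where
  "preord_interval lesim i j = {k. lesim i k \<and> lesim k j}"

definition preord_convex :: "('i \<Rightarrow> 'i \<Rightarrow> bool) \<Rightarrow> 'i set \<Rightarrow> bool" where
  "preord_convex lesim L \<longleftrightarrow> (\<forall>i\<in>L. \<forall>j\<in>L. preord_interval lesim i j \<subseteq> L)"

definition strongly_convex :: "('i \<Rightarrow> 'i \<Rightarrow> bool) \<Rightarrow> 'i set \<Rightarrow> bool" where
  "strongly_convex lesim L \<longleftrightarrow>
     (\<forall>i. i \<notin> L \<longrightarrow> (\<forall>j\<in>L. preord_less lesim i j) \<or> (\<forall>j\<in>L. preord_less lesim j i))"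

definition Z_like :: "('i \<Rightarrow> 'i \<Rightarrow> bool) \<Rightarrow> bool" where
  "Z_like lesim \<longleftrightarrow> (\<forall>A. finite A \<longrightarrow> (\<exists>L. finite L \<and> strongly_convex lesim L \<and> A \<subseteq> L))"

text \<open>
  The smallest preorder that contains \<open>lesim\<close> and makes all elements of \<open>L\<close> equivalent is the
  reflexive transitive closure of the union of \<open>lesim\<close> and \<open>L \<times> L\<close>.
\<close>

definition preord_merge :: "('i \<Rightarrow> 'i \<Rightarrow> bool) \<Rightarrow> 'i set \<Rightarrow> 'i \<Rightarrow> 'i \<Rightarrow> bool" where
  "preord_merge lesim L = rtranclp (\<lambda>i j. lesim i j \<or> (i \<in> L \<and> j \<in> L))"

section \<open>Infinite matrices\<close>

type_synonym ('i, 'r) imat = "'i \<times> 'i \<Rightarrow> 'r"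

text \<open>
  \<^const>\<open>Sum_any\<close> sums over the nonzero terms. Where infinitely many terms are nonzero, so that the
  product is undefined, it yields the dummy value \<open>0\<close>.
\<close>

definition imat_mult :: "('i, 'r::comm_ring_1) imat \<Rightarrow> ('i, 'r) imat \<Rightarrow> ('i, 'r) imat" where
  "imat_mult a b = (\<lambda>(i, j). Sum_any (\<lambda>k. a (i, k) * b (k, j)))"

definition imat_one :: "('i, 'r::comm_ring_1) imat" where
  "imat_one = (\<lambda>(i, j). if i = j then 1 else 0)"

definition invertible_on :: "'i set \<Rightarrow> ('i, 'r::comm_ring_1) imat \<Rightarrow> bool" where
  "invertible_on L a \<longleftrightarrow>
     (\<exists>b :: ('i, 'r) imat. \<forall>i\<in>L. \<forall>j\<in>L.
        (\<Sum>k\<in>L. a (i, k) * b (k, j)) = (if i = j then 1 else 0) \<and>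
        (\<Sum>k\<in>L. b (i, k) * a (k, j)) = (if i = j then 1 else 0))"

definition nonsingular :: "('i \<Rightarrow> 'i \<Rightarrow> bool) \<Rightarrow> ('i, 'r::comm_ring_1) imat \<Rightarrow> bool" where
  "nonsingular lesim a \<longleftrightarrow>
     (\<exists>L. finite L \<and> preord_convex lesim L \<and>
        (\<forall>M. finite M \<and> preord_convex lesim M \<and> L \<subseteq> M \<longrightarrow> invertible_on M a))"

definition upper_triangular :: "('i \<Rightarrow> 'i \<Rightarrow> bool) \<Rightarrow> ('i, 'r::comm_ring_1) imat \<Rightarrow> bool" where
  "upper_triangular lesim a \<longleftrightarrow> (\<forall>i j. \<not> lesim i j \<longrightarrow> a (i, j) = 0)"

definition almost_upper_triangular ::
    "('i \<Rightarrow> 'i \<Rightarrow> bool) \<Rightarrow> ('i, 'r::comm_ring_1) imat \<Rightarrow> bool" where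
  "almost_upper_triangular lesim a \<longleftrightarrow> finite {(i, j). \<not> lesim i j \<and> a (i, j) \<noteq> 0}"

definition scalar_imat :: "('i, 'r::comm_ring_1) imat \<Rightarrow> bool" where
  "scalar_imat a \<longleftrightarrow> (\<forall>i j. i \<noteq> j \<longrightarrow> a (i, j) = 0) \<and> (\<exists>c. \<forall>i. a (i, i) = c)"

definition U_set :: "('i \<Rightarrow> 'i \<Rightarrow> bool) \<Rightarrow> ('i, 'r::comm_ring_1) imat set" where
  "U_set lesim = {a. nonsingular lesim a \<and> upper_triangular lesim a}"

definition AU_set :: "('i \<Rightarrow> 'i \<Rightarrow> bool) \<Rightarrow> ('i, 'r::comm_ring_1) imat set" where
  "AU_set lesim = {a. nonsingular lesim a \<and> almost_upper_triangular lesim a}"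

definition Z_set :: "('i \<Rightarrow> 'i \<Rightarrow> bool) \<Rightarrow> ('i, 'r::comm_ring_1) imat set" where
  "Z_set lesim = {a. nonsingular lesim a \<and> scalar_imat a}"

definition AU_group :: "('i \<Rightarrow> 'i \<Rightarrow> bool) \<Rightarrow> ('i, 'r::comm_ring_1) imat monoid" where
  "AU_group lesim = \<lparr>carrier = AU_set lesim, mult = imat_mult, one = imat_one\<rparr>"

section \<open>Topological groups\<close>

definition group_topology :: "('a, 'm) monoid_scheme \<Rightarrow> 'a topology \<Rightarrow> bool" where
  "group_topology G T \<longleftrightarrow>
     group G \<and> topspace T = carrier G \<and>
     continuous_map (prod_topology T T) T (\<lambda>(x, y). x \<otimes>\<^bsub>G\<^esub> y) \<and>
     continuous_map T T (\<lambda>x. inv\<^bsub>G\<^esub> x)"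

definition proper_closed_normal ::
    "('a, 'm) monoid_scheme \<Rightarrow> 'a topology \<Rightarrow> 'a set \<Rightarrow> bool" where
  "proper_closed_normal G T N \<longleftrightarrow> N \<lhd> G \<and> closedin T N \<and> N \<noteq> carrier G"

definition topologically_simple :: "('a, 'm) monoid_scheme \<Rightarrow> 'a topology \<Rightarrow> bool" where
  "topologically_simple G T \<longleftrightarrow>
     group_topology G T \<and> carrier G \<noteq> {\<one>\<^bsub>G\<^esub>} \<and>
     (\<forall>N. N \<lhd> G \<and> closedin T N \<longrightarrow> N = {\<one>\<^bsub>G\<^esub>} \<or> N = carrier G)"

definition coset_topology ::
    "('a, 'm) monoid_scheme \<Rightarrow> 'a topology \<Rightarrow> 'a set \<Rightarrow> 'a set topology" where
  "coset_topology G T N =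
     topology (\<lambda>V. V \<subseteq> carrier (G Mod N) \<and> openin T {x \<in> topspace T. N #>\<^bsub>G\<^esub> x \<in> V})"

lemma openin_coset_topology:
  "openin (coset_topology G T N) V \<longleftrightarrow>
     V \<subseteq> carrier (G Mod N) \<and> openin T {x \<in> topspace T. N #>\<^bsub>G\<^esub> x \<in> V}"
proof -
  let ?P = "\<lambda>V. V \<subseteq> carrier (G Mod N) \<and> openin T {x \<in> topspace T. N #>\<^bsub>G\<^esub> x \<in> V}"
  have "istopology ?P"
    unfolding istopology_def
  proof (intro conjI allI impI)
    fix S S' assume "?P S" "?P S'"
    moreover have "{x \<in> topspace T. N #>\<^bsub>G\<^esub> x \<in> S \<inter> S'} =
        {x \<in> topspace T. N #>\<^bsub>G\<^esub> x \<in> S} \<inter> {x \<in> topspace T. N #>\<^bsub>G\<^esub> x \<in> S'}"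
      by blast
    ultimately show "S \<inter> S' \<subseteq> carrier (G Mod N)"
      "openin T {x \<in> topspace T. N #>\<^bsub>G\<^esub> x \<in> S \<inter> S'}"
      by auto
  next
    fix \<K> assume *: "\<forall>K\<in>\<K>. ?P K"
    then show "\<Union>\<K> \<subseteq> carrier (G Mod N)" by blast
    have "{x \<in> topspace T. N #>\<^bsub>G\<^esub> x \<in> \<Union>\<K>} = (\<Union>K\<in>\<K>. {x \<in> topspace T. N #>\<^bsub>G\<^esub> x \<in> K})"
      by blast
    with * show "openin T {x \<in> topspace T. N #>\<^bsub>G\<^esub> x \<in> \<Union>\<K>}"
      by auto
  qed
  then show ?thesis
    by (simp add: coset_topology_def topology_inverse')
qed

lemma quotient_map_coset_topology:
  assumes "topspace T = carrier G"
  shows "quotient_map T (coset_topology G T N) (\<lambda>x. N #>\<^bsub>G\<^esub> x)"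
proof -
  have eq: "{x \<in> topspace T. N #>\<^bsub>G\<^esub> x \<in> carrier (G Mod N)} = topspace T"
    using assms by (auto simp: FactGroup_def RCOSETS_def)
  have "openin (coset_topology G T N) (carrier (G Mod N))"
    by (simp add: openin_coset_topology eq)
  then have top: "topspace (coset_topology G T N) = carrier (G Mod N)"
    by (metis openin_coset_topology openin_subset openin_topspace subset_antisym)
  have "(\<lambda>x. N #>\<^bsub>G\<^esub> x) ` topspace T = carrier (G Mod N)"
    using assms by (auto simp: FactGroup_def RCOSETS_def)
  then show ?thesis
    by (auto simp: quotient_map_def top openin_coset_topology)
qed

section \<open>The topologies on the matrix groups\<close>

definition U_topology :: "('i \<Rightarrow> 'i \<Rightarrow> bool) \<Rightarrow> ('i, 'r::comm_ring_1) imat topology" where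
  "U_topology lesim =
     subtopology (product_topology (\<lambda>_. discrete_topology UNIV) UNIV) (U_set lesim)"

definition is_AU_topology ::
    "('i \<Rightarrow> 'i \<Rightarrow> bool) \<Rightarrow> ('i, 'r::comm_ring_1) imat topology \<Rightarrow> bool" where
  "is_AU_topology lesim T \<longleftrightarrow>
     group_topology (AU_group lesim) T \<and>
     (\<forall>L. finite L \<and> preord_convex lesim L \<longrightarrow>
        continuous_map (U_topology (preord_merge lesim L)) T (\<lambda>a. a) \<and>
        open_map (U_topology (preord_merge lesim L)) T (\<lambda>a. a))"

definition AU_topology :: "('i \<Rightarrow> 'i \<Rightarrow> bool) \<Rightarrow> ('i, 'r::comm_ring_1) imat topology" where
  "AU_topology lesim = (THE T. is_AU_topology lesim T)"

end

theory Submission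
  imports Defs
begin

text \<open>
  A matrix is almost upper triangular iff it is upper triangular for some \<open>\<Lambda> + L\<close> with \<open>L\<close> finite
  and strongly convex, and every finite set lies in a finite set that is convex for \<open>\<Lambda> + L\<close>;
  all products and inverses are therefore computed in finite blocks. This also shows that the
  topology of \<open>AU\<close> is the one in which a basic neighbourhood of \<open>x\<close> prescribes finitely
  many entries and all entries below the diagonal.

  Let \<open>N\<close> be a closed normal subgroup with a nonscalar element \<open>x\<close>. The commutator of \<open>x\<close> with a
  suitable elementary matrix differs from \<open>1\<close> by a matrix that has rank one outside a single
  column; further commutators turn it into \<open>1 + a w\<close> with a finitely supported column \<open>a\<close>, then
  into \<open>1 + b e\<^sub>l\<close>, then into an elementary matrix, and so \<open>N\<close> contains all elementary
  matrices. As \<open>\<Lambda>\<close> is infinite and \<open>N\<close> is closed, a diagonal entry \<open>c\<^sup>-\<^sup>1\<close> can be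
  pushed out of every finite set, which yields the diagonal matrices with one entry \<open>c \<noteq> 1\<close>. By Gaussian
  elimination \<open>N\<close> contains all finitary invertible matrices, and these are dense.
\<close>

section \<open>Triangular matrices over a preorder with finite convex hulls\<close>

lemma imat_mult_eq_sum:
  assumes "finite K" and "\<And>k. k \<notin> K \<Longrightarrow> a (i, k) * b (k, j) = 0"
  shows "imat_mult a b (i, j) = (\<Sum>k\<in>K. a (i, k) * b (k, j))"
  unfolding imat_mult_def using assms
  by (auto intro!: Sum_any.expand_superset)

lemma preord_convexD:
  "preord_convex r M \<Longrightarrow> i \<in> M \<Longrightarrow> j \<in> M \<Longrightarrow> r i k \<Longrightarrow> r k j \<Longrightarrow> k \<in> M"
  unfolding preord_convex_def preord_interval_def by blast

lemma upper_triangular_mult_eq_0: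
  assumes "upper_triangular r a" "upper_triangular r b" "\<not> (r i k \<and> r k j)"
  shows "a (i, k) * b (k, j) = 0"
  using assms by (auto simp: upper_triangular_def)

lemma upper_triangular_mult_eq_sum:
  assumes "upper_triangular r a" "upper_triangular r b"
    and "finite M" "preord_convex r M" "i \<in> M" "j \<in> M"
  shows "imat_mult a b (i, j) = (\<Sum>k\<in>M. a (i, k) * b (k, j))"
  using upper_triangular_mult_eq_0[OF assms(1,2)] preord_convexD[OF assms(4-6)]
  by (intro imat_mult_eq_sum assms(3)) blast

definition inverse_on :: "'i set \<Rightarrow> ('i, 'r::comm_ring_1) imat \<Rightarrow> ('i, 'r) imat \<Rightarrow> bool" where
  "inverse_on M a b \<longleftrightarrow> (\<forall>i\<in>M. \<forall>j\<in>M.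
     (\<Sum>k\<in>M. a (i, k) * b (k, j)) = (if i = j then 1 else 0) \<and>
     (\<Sum>k\<in>M. b (i, k) * a (k, j)) = (if i = j then 1 else 0))"

lemma invertible_on_iff: "invertible_on M a \<longleftrightarrow> (\<exists>b. inverse_on M a b)"
  by (simp add: invertible_on_def inverse_on_def)

lemma inverse_on_left_cancel:
  fixes a :: "('i, 'r::comm_ring_1) imat"
  assumes "finite M" "inverse_on M a c" "i \<in> M"
  shows "(\<Sum>k\<in>M. c (i, k) * (\<Sum>l\<in>M. a (k, l) * f l)) = f i"
proof -
  have "(\<Sum>k\<in>M. c (i, k) * (\<Sum>l\<in>M. a (k, l) * f l))
      = (\<Sum>k\<in>M. \<Sum>l\<in>M. c (i, k) * a (k, l) * f l)"
    by (simp add: sum_distrib_left mult.assoc)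
  also have "\<dots> = (\<Sum>l\<in>M. (\<Sum>k\<in>M. c (i, k) * a (k, l)) * f l)"
    by (subst sum.swap) (simp add: sum_distrib_right)
  also have "\<dots> = (\<Sum>l\<in>M. if l = i then f l else 0)"
    using assms by (intro sum.cong) (auto simp: inverse_on_def)
  also have "\<dots> = f i"
    using assms by simp
  finally show ?thesis .
qed

text \<open>On the block, \<open>c = c (a b) = b\<close>. This turns a mere right inverse, such as a
  triangular preimage of the identity, into a two-sided one.\<close>

lemma right_inverse_on_eq:
  assumes "finite M" "inverse_on M a c"
    and "\<And>i j. i \<in> M \<Longrightarrow> j \<in> M \<Longrightarrow> (\<Sum>k\<in>M. a (i, k) * b (k, j)) = (if i = j then 1 else 0)"
    and "i \<in> M" "j \<in> M"
  shows "c (i, j) = b (i, j)"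
proof -
  have "b (i, j) = (\<Sum>k\<in>M. c (i, k) * (\<Sum>l\<in>M. a (k, l) * b (l, j)))"
    using inverse_on_left_cancel[OF assms(1,2,4), of "\<lambda>l. b (l, j)"] by simp
  also have "\<dots> = (\<Sum>k\<in>M. if k = j then c (i, k) else 0)"
    using assms(3,5) by (intro sum.cong) auto
  also have "\<dots> = c (i, j)"
    using assms by simp
  finally show ?thesis ..
qed

lemma inverse_on_unique:
  assumes "finite M" "inverse_on M a c" "inverse_on M a b" "i \<in> M" "j \<in> M"
  shows "c (i, j) = b (i, j)"
  by (rule right_inverse_on_eq[OF assms(1,2) _ assms(4,5)]) (use assms(3) in \<open>auto simp: inverse_on_def\<close>)

lemma inverse_on_cong:
  assumes "\<And>i j. i \<in> M \<Longrightarrow> j \<in> M \<Longrightarrow> a (i, j) = a' (i, j)"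
    and "\<And>i j. i \<in> M \<Longrightarrow> j \<in> M \<Longrightarrow> b (i, j) = b' (i, j)"
  shows "inverse_on M a b \<longleftrightarrow> inverse_on M a' b'"
proof -
  have "(\<Sum>k\<in>M. a (i, k) * b (k, j)) = (\<Sum>k\<in>M. a' (i, k) * b' (k, j))"
    "(\<Sum>k\<in>M. b (i, k) * a (k, j)) = (\<Sum>k\<in>M. b' (i, k) * a' (k, j))"
    if "i \<in> M" "j \<in> M" for i j
    using that assms by (auto intro!: sum.cong)
  then show ?thesis
    by (auto simp: inverse_on_def)
qed

text \<open>A nonzero term \<open>a (i, k) * b (k, j)\<close> has \<open>r i k\<close> and
  \<open>r k j\<close>, so convexity confines \<open>k\<close> to \<open>M'\<close>: the sums over
  \<open>M\<close> and over \<open>M'\<close> coincide.\<close>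

lemma inverse_on_subset:
  assumes "upper_triangular r a" "upper_triangular r b" "finite M" "M' \<subseteq> M" "preord_convex r M'"
    and "inverse_on M a b"
  shows "inverse_on M' a b"
proof -
  have "(\<Sum>k\<in>M'. x (i, k) * y (k, j)) = (\<Sum>k\<in>M. x (i, k) * y (k, j))"
    if "i \<in> M'" "j \<in> M'" "upper_triangular r x" "upper_triangular r y"
    for i j and x y :: "('a, 'b) imat"
    using upper_triangular_mult_eq_0[OF that(3,4)] preord_convexD[OF assms(5) that(1,2)]
    by (intro sum.mono_neutral_left assms(3,4)) blast
  with assms show ?thesis
    by (auto simp: inverse_on_def subset_iff)
qed

text \<open>
  Over a finite ring the triangular matrices on \<open>M\<close> form a finite set, so that the injective left
  multiplication by \<open>a\<close> is onto, and the identity matrix has a triangular preimage.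
\<close>

lemma upper_triangular_inverse_on:
  fixes a :: "('i, 'r::{comm_ring_1, finite}) imat"
  assumes r: "reflp r" "transp r" and "finite M" "upper_triangular r a" "invertible_on M a"
  shows "\<exists>b. upper_triangular r b \<and> inverse_on M a b"
proof -
  obtain c where c: "inverse_on M a c"
    using assms by (auto simp: invertible_on_iff)
  define X where "X = {b :: ('i, 'r) imat. upper_triangular r b \<and> (\<forall>p. p \<notin> M \<times> M \<longrightarrow> b p = 0)}"
  have "finite {b :: ('i, 'r) imat. \<forall>p. (p \<in> M \<times> M \<longrightarrow> b p \<in> UNIV) \<and> (p \<notin> M \<times> M \<longrightarrow> b p = 0)}"
    by (rule finite_set_of_finite_funs) (use assms in auto)
  then have finX: "finite X"
    by (rule rev_finite_subset) (auto simp: X_def)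
  define \<phi> where "\<phi> = (\<lambda>b :: ('i, 'r) imat. \<lambda>(i, j).
    if i \<in> M \<and> j \<in> M then \<Sum>k\<in>M. a (i, k) * b (k, j) else 0)"
  have "\<phi> b \<in> X" if "b \<in> X" for b
  proof -
    have "(\<Sum>k\<in>M. a (i, k) * b (k, j)) = 0" if "\<not> r i j" for i j
    proof (rule sum.neutral, rule ballI)
      fix k
      have "\<not> (r i k \<and> r k j)"
        using \<open>\<not> r i j\<close> r by (meson transpD)
      then show "a (i, k) * b (k, j) = 0"
        using \<open>b \<in> X\<close> assms by (auto simp: X_def upper_triangular_def)
    qed
    then show ?thesis
      by (auto simp: X_def \<phi>_def upper_triangular_def)
  qed
  moreover have "inj_on \<phi> X"
  proof (rule inj_onI, rule ext)
    fix b b' :: "('i, 'r) imat" and p :: "'i \<times> 'i" assume *: "b \<in> X" "b' \<in> X" "\<phi> b = \<phi> b'"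
    obtain i j where p: "p = (i, j)" by fastforce
    show "b p = b' p"
    proof (cases "i \<in> M \<and> j \<in> M")
      case True
      have "(\<Sum>l\<in>M. a (k, l) * b (l, j)) = (\<Sum>l\<in>M. a (k, l) * b' (l, j))" if "k \<in> M" for k
        using fun_cong[OF *(3), of "(k, j)"] that True by (simp add: \<phi>_def)
      then have "(\<Sum>k\<in>M. c (i, k) * (\<Sum>l\<in>M. a (k, l) * b (l, j)))
          = (\<Sum>k\<in>M. c (i, k) * (\<Sum>l\<in>M. a (k, l) * b' (l, j)))"
        by simp
      then show ?thesis
        using inverse_on_left_cancel[OF assms(3) c, of i] True p by simp
    qed (use * p in \<open>auto simp: X_def\<close>)
  qed
  ultimately have "\<phi> ` X = X"
    using finX by (intro endo_inj_surj) auto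
  moreover have "(\<lambda>(i, j). if i = j \<and> i \<in> M then 1 else 0) \<in> X"
    using r by (auto simp: X_def upper_triangular_def reflp_def)
  ultimately obtain b where b: "b \<in> X" "\<phi> b = (\<lambda>(i, j). if i = j \<and> i \<in> M then 1 else 0)"
    by (metis (no_types, lifting) imageE)
  have ab: "(\<Sum>k\<in>M. a (i, k) * b (k, j)) = (if i = j then 1 else 0)" if "i \<in> M" "j \<in> M" for i j
    using fun_cong[OF b(2), of "(i, j)"] that by (simp add: \<phi>_def)
  have "inverse_on M a b"
    using right_inverse_on_eq[OF assms(3) c ab] c
    by (subst inverse_on_cong[of M a a b c]) auto
  with b show ?thesis
    by (auto simp: X_def)
qed

text \<open>Isolates what the matrix calculus rests on: two indices lie in a finite convex set, and
  that set contains all intermediate indices of a product of triangular matrices. Every merge of a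
  Z-like preorder with a finite set is an instance.\<close>

locale finite_hull_preorder =
  fixes r :: "'i \<Rightarrow> 'i \<Rightarrow> bool"
  assumes refl: "reflp r" and trans: "transp r"
    and hull: "finite A \<Longrightarrow> \<exists>M. finite M \<and> preord_convex r M \<and> A \<subseteq> M"
begin

lemma upper_triangular_one: "upper_triangular r imat_one"
  using refl by (auto simp: upper_triangular_def imat_one_def reflp_def)

lemma upper_triangular_mult:
  assumes "upper_triangular r a" "upper_triangular r b"
  shows "upper_triangular r (imat_mult a b)"
  unfolding upper_triangular_def
proof (intro allI impI)
  fix i j assume "\<not> r i j"
  then have "a (i, k) * b (k, j) = 0" for k
    using assms trans by (metis mult_zero_left mult_zero_right transpD upper_triangular_def)
  then show "imat_mult a b (i, j) = 0"
    by (simp add: imat_mult_def)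
qed

lemma imat_mult_assoc:
  assumes abc: "upper_triangular r a" "upper_triangular r b" "upper_triangular r c"
  shows "imat_mult (imat_mult a b) c = imat_mult a (imat_mult b c)"
proof (rule ext, clarify)
  fix i j
  obtain M where M: "finite M" "preord_convex r M" "i \<in> M" "j \<in> M"
    using hull[of "{i, j}"] by auto
  note sums = upper_triangular_mult_eq_sum[OF _ _ M(1,2)] upper_triangular_mult abc M
  have "imat_mult (imat_mult a b) c (i, j) = (\<Sum>k\<in>M. \<Sum>l\<in>M. a (i, l) * b (l, k) * c (k, j))"
    by (simp add: sums sum_distrib_right)
  also have "\<dots> = (\<Sum>l\<in>M. \<Sum>k\<in>M. a (i, l) * b (l, k) * c (k, j))"
    by (rule sum.swap)
  also have "\<dots> = imat_mult a (imat_mult b c) (i, j)"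
    by (simp add: sums sum_distrib_left mult.assoc)
  finally show "imat_mult (imat_mult a b) c (i, j) = imat_mult a (imat_mult b c) (i, j)" .
qed

lemma inverse_on_of_inverse:
  assumes "upper_triangular r a" "upper_triangular r b"
    and "imat_mult a b = imat_one" "imat_mult b a = imat_one"
    and "finite M" "preord_convex r M"
  shows "inverse_on M a b"
  unfolding inverse_on_def
  using upper_triangular_mult_eq_sum[OF assms(1,2,5,6)]
    upper_triangular_mult_eq_sum[OF assms(2,1,5,6)] assms(3,4)
  by (auto simp: imat_one_def)

text \<open>A global inverse restricts to an inverse on every finite convex block, so any finite
  convex set can serve as the threshold in \<open>nonsingular\<close>.\<close>

lemma nonsingular_of_inverse:
  assumes "upper_triangular r a" "upper_triangular r b"
    and "imat_mult a b = imat_one" "imat_mult b a = imat_one"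
  shows "nonsingular r a"
  unfolding nonsingular_def invertible_on_iff
  using inverse_on_of_inverse[OF assms] hull[of "{}"] by blast

text \<open>Every finite convex block beyond the threshold has a triangular inverse. The inverses of
  two blocks agree on the overlap, since both are restrictions of the inverse on a common hull, and
  so they glue to one matrix.\<close>

lemma upper_triangular_inverse:
  fixes a :: "('i, 'r::{comm_ring_1, finite}) imat"
  assumes a: "upper_triangular r a" "nonsingular r a"
  shows "\<exists>b. upper_triangular r b \<and> imat_mult a b = imat_one \<and> imat_mult b a = imat_one"
proof -
  obtain L where L: "finite L" "\<And>M. finite M \<Longrightarrow> preord_convex r M \<Longrightarrow> L \<subseteq> M \<Longrightarrow> invertible_on M a"
    using a(2) by (auto simp: nonsingular_def)
  have "\<exists>b. upper_triangular r b \<and> inverse_on M a b"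
    if "finite M" "preord_convex r M" "L \<subseteq> M" for M
    using upper_triangular_inverse_on[OF refl trans _ a(1)] L that by blast
  then obtain B where B: "upper_triangular r (B M)" "inverse_on M a (B M)"
    if "finite M" "preord_convex r M" "L \<subseteq> M" for M
    by metis
  have B_eq: "B M (i, j) = B M' (i, j)"
    if "finite M" "preord_convex r M" "L \<subseteq> M" "finite M'" "preord_convex r M'" "L \<subseteq> M'"
      "i \<in> M \<inter> M'" "j \<in> M \<inter> M'" for M M' i j
  proof -
    obtain H where H: "finite H" "preord_convex r H" "M \<union> M' \<subseteq> H"
      using hull[of "M \<union> M'"] \<open>finite M\<close> \<open>finite M'\<close> by auto
    then have "L \<subseteq> H" using that by blast
    then have BH: "inverse_on M a (B H)" "inverse_on M' a (B H)"
      using inverse_on_subset[OF a(1) B(1)[OF H(1,2)] H(1) _ _ B(2)[OF H(1,2)]] that H(3) by auto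
    have "B M (i, j) = B H (i, j)"
      using inverse_on_unique[OF _ B(2) BH(1)] that by auto
    also have "\<dots> = B M' (i, j)"
      using inverse_on_unique[OF _ BH(2) B(2)] that by auto
    finally show ?thesis .
  qed
  obtain C where C: "finite (C A)" "preord_convex r (C A)" "A \<subseteq> C A" if "finite A" for A
    using hull by metis
  \<comment> \<open>\<open>L\<close> is adjoined to \<open>{i, j}\<close> because block inverses are
    available only for blocks that contain the threshold set of \<open>a\<close>.\<close>
  define b where "b = (\<lambda>(i, j). B (C (L \<union> {i, j})) (i, j))"
  have b_eq: "b (i, j) = B M (i, j)"
    if "finite M" "preord_convex r M" "L \<subseteq> M" "i \<in> M" "j \<in> M" for M i j
    using B_eq[of "C (L \<union> {i, j})" M i j] that C[of "L \<union> {i, j}"] L(1) by (auto simp: b_def)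
  have upper_b: "upper_triangular r b"
    unfolding upper_triangular_def
  proof (intro allI impI)
    fix i j assume "\<not> r i j"
    moreover have "upper_triangular r (B (C (L \<union> {i, j})))"
      using C[of "L \<union> {i, j}"] L(1) by (intro B(1)) auto
    ultimately show "b (i, j) = 0"
      by (simp add: b_def upper_triangular_def)
  qed
  have "imat_mult a b (i, j) = imat_one (i, j) \<and> imat_mult b a (i, j) = imat_one (i, j)" for i j
  proof -
    obtain M where M: "finite M" "preord_convex r M" "L \<subseteq> M" "i \<in> M" "j \<in> M"
      using hull[of "L \<union> {i, j}"] L(1) by auto
    have "inverse_on M a b"
      using B(2)[OF M(1-3)] b_eq[OF M(1-3)] by (subst inverse_on_cong[of M a a b "B M"]) auto
    then show ?thesis
      using M upper_triangular_mult_eq_sum[OF a(1) upper_b M(1,2,4,5)]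
        upper_triangular_mult_eq_sum[OF upper_b a(1) M(1,2,4,5)]
      by (auto simp: inverse_on_def imat_one_def)
  qed
  with upper_b show ?thesis
    by fastforce
qed

end

section \<open>The group of almost upper triangular matrices\<close>

lemma imat_one_mult [simp]: "imat_mult imat_one a = a"
  by (rule ext, clarify, subst imat_mult_eq_sum[of "{_}"]) (auto simp: imat_one_def)

lemma imat_mult_one [simp]: "imat_mult a imat_one = a"
proof (rule ext, clarify)
  fix i j
  show "imat_mult a imat_one (i, j) = a (i, j)"
    by (subst imat_mult_eq_sum[of "{j}"]) (auto simp: imat_one_def)
qed

section \<open>Merging a finite set of indices\<close>

lemma strongly_convexD:
  assumes "strongly_convex r M" "i \<notin> M"
  shows "(\<forall>j\<in>M. r i j \<and> \<not> r j i) \<or> (\<forall>j\<in>M. r j i \<and> \<not> r i j)"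
  using assms unfolding strongly_convex_def preord_less_def preord_equiv_def by blast

text \<open>A chain with several steps inside \<open>L\<close> can be shortened to one with a single
  such step: from its first entry \<open>p\<close> into \<open>L\<close> directly to its last exit
  \<open>q\<close>.\<close>

lemma preord_merge_iff:
  assumes "reflp r" "transp r"
  shows "preord_merge r L i j \<longleftrightarrow> r i j \<or> (\<exists>p\<in>L. \<exists>q\<in>L. r i p \<and> r q j)"
proof
  assume "preord_merge r L i j"
  then show "r i j \<or> (\<exists>p\<in>L. \<exists>q\<in>L. r i p \<and> r q j)"
    unfolding preord_merge_def
  proof (induction rule: rtranclp_induct)
    case base
    then show ?case
      using assms by (simp add: reflp_def)
  next
    case (step j k)
    have refl: "r k k" and trans: "\<And>x. r x j \<Longrightarrow> r j k \<Longrightarrow> r x k"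
      using assms by (auto simp: reflp_def dest: transpD)
    from step(2,3) refl trans show ?case
      by blast
  qed
next
  assume *: "r i j \<or> (\<exists>p\<in>L. \<exists>q\<in>L. r i p \<and> r q j)"
  let ?s = "\<lambda>i j. r i j \<or> (i \<in> L \<and> j \<in> L)"
  have "?s\<^sup>*\<^sup>* i j" if "r i p" "p \<in> L" "q \<in> L" "r q j" for p q
  proof -
    have "?s\<^sup>*\<^sup>* i p" "?s\<^sup>*\<^sup>* p q" "?s\<^sup>*\<^sup>* q j"
      using that by (auto intro!: r_into_rtranclp)
    then show ?thesis
      by (meson rtranclp_trans)
  qed
  with * show "preord_merge r L i j"
    unfolding preord_merge_def by (auto intro: r_into_rtranclp)
qed

lemma preord_merge_mono:
  assumes "reflp r" "transp r" "L \<subseteq> M" "preord_merge r L i j"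
  shows "preord_merge r M i j"
  using assms by (auto simp: preord_merge_iff)

lemma upper_triangular_merge_mono:
  assumes "reflp r" "transp r" "L \<subseteq> M" "upper_triangular (preord_merge r L) a"
  shows "upper_triangular (preord_merge r M) a"
  using assms(4) preord_merge_mono[OF assms(1-3)] unfolding upper_triangular_def by blast

locale Z_like_preorder =
  fixes r :: "'i \<Rightarrow> 'i \<Rightarrow> bool"
  assumes reflp: "reflp r" and transp: "transp r" and Z_like: "Z_like r"
begin

lemma sconvex_hull:
  assumes "finite A"
  obtains M where "finite M" "strongly_convex r M" "A \<subseteq> M"
  using Z_like assms unfolding Z_like_def by blast

lemma merge_iff: "preord_merge r L i j \<longleftrightarrow> r i j \<or> (\<exists>p\<in>L. \<exists>q\<in>L. r i p \<and> r q j)"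
  using preord_merge_iff[OF reflp transp] .

lemma r_refl [simp]: "r i i"
  using reflp by (simp add: reflp_def)

lemma r_trans: "r i j \<Longrightarrow> r j k \<Longrightarrow> r i k"
  using transp by (meson transpD)

lemma r_imp_merge: "r i j \<Longrightarrow> preord_merge r L i j"
  by (simp add: merge_iff)

text \<open>A point outside \<open>M\<close> lies strictly below or strictly above all of
  \<open>M\<close>. If \<open>i\<close> were outside, \<open>r i p\<close> would put it below
  \<open>q\<close> as well, and \<open>r i q\<close>, \<open>r q j\<close> would give
  \<open>r i j\<close>; dually for \<open>j\<close>.\<close>

lemma merge_imp_in_sconvex:
  assumes "strongly_convex r M" "L \<subseteq> M" "preord_merge r L i j" "\<not> r i j"
  shows "i \<in> M \<and> j \<in> M"
proof -
  obtain p q where "p \<in> M" "q \<in> M" "r i p" "r q j"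
    using assms by (auto simp: merge_iff)
  then show ?thesis
    using strongly_convexD[OF assms(1), of i] strongly_convexD[OF assms(1), of j] assms(4) r_trans
    by blast
qed

lemma merge_sconvex_iff:
  "strongly_convex r L \<Longrightarrow> preord_merge r L i j \<longleftrightarrow> r i j \<or> (i \<in> L \<and> j \<in> L)"
  using merge_imp_in_sconvex[of L L i j] r_refl merge_iff[of L i j] by blast

lemma sconvex_imp_convex:
  assumes "strongly_convex r M"
  shows "preord_convex r M"
  unfolding preord_convex_def preord_interval_def
  using strongly_convexD[OF assms] by blast

text \<open>If \<open>k\<close> lies between two points of \<open>M\<close> in the merged order,
  replacing a detour through \<open>L\<close> by its endpoint in \<open>L\<close> yields points of
  \<open>M\<close> on both sides of \<open>k\<close> for \<open>r\<close> itself.\<close>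

lemma convex_merge:
  assumes "preord_convex r M" "L \<subseteq> M"
  shows "preord_convex (preord_merge r L) M"
  unfolding preord_convex_def preord_interval_def
proof clarify
  fix i j k assume ij: "i \<in> M" "j \<in> M" and "preord_merge r L i k" "preord_merge r L k j"
  then obtain i' j' where "i' \<in> M" "r i' k" "j' \<in> M" "r k j'"
    using assms(2) by (auto simp: merge_iff)
  then show "k \<in> M"
    using preord_convexD[OF assms(1)] by blast
qed

lemma merge_convex:
  assumes "preord_convex (preord_merge r L) M"
  shows "preord_convex r M"
  using assms unfolding preord_convex_def preord_interval_def merge_iff by blast

lemma finite_hull_preorder_merge:
  assumes "finite L"
  shows "finite_hull_preorder (preord_merge r L)"
proof
  show "reflp (preord_merge r L)" "transp (preord_merge r L)"
    by (auto simp: preord_merge_def reflp_def transp_def)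
next
  fix A :: "'i set" assume "finite A"
  then obtain M where "finite M" "strongly_convex r M" "A \<union> L \<subseteq> M"
    using sconvex_hull[of "A \<union> L"] assms by auto
  then show "\<exists>M. finite M \<and> preord_convex (preord_merge r L) M \<and> A \<subseteq> M"
    using convex_merge sconvex_imp_convex by blast
qed

text \<open>Among the sets that contain \<open>L\<close>, convexity for \<open>r\<close> and for the
  merged preorder coincide. A threshold for one, enlarged to a strongly convex set containing
  \<open>L\<close>, is therefore a threshold for the other.\<close>

lemma nonsingular_merge:
  assumes "finite L"
  shows "nonsingular (preord_merge r L) a \<longleftrightarrow> nonsingular r a"
proof
  assume "nonsingular (preord_merge r L) a"
  then obtain P where P: "finite P"
    "\<And>M. finite M \<Longrightarrow> preord_convex (preord_merge r L) M \<Longrightarrow> P \<subseteq> M \<Longrightarrow> invertible_on M a"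
    by (auto simp: nonsingular_def)
  obtain Q where "finite Q" "strongly_convex r Q" "L \<union> P \<subseteq> Q"
    using sconvex_hull[of "L \<union> P"] assms P(1) by auto
  with P show "nonsingular r a"
    unfolding nonsingular_def using sconvex_imp_convex convex_merge
    by (metis Un_subset_iff subset_trans)
next
  assume "nonsingular r a"
  then obtain P where P: "finite P"
    "\<And>M. finite M \<Longrightarrow> preord_convex r M \<Longrightarrow> P \<subseteq> M \<Longrightarrow> invertible_on M a"
    by (auto simp: nonsingular_def)
  obtain Q where "finite Q" "strongly_convex r Q" "L \<union> P \<subseteq> Q"
    using sconvex_hull[of "L \<union> P"] assms P(1) by auto
  then show "nonsingular (preord_merge r L) a"
    unfolding nonsingular_def using P(2) sconvex_imp_convex convex_merge merge_convex
    by (metis Un_subset_iff subset_trans)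
qed

text \<open>Merging the row and column indices of the finitely many exceptional entries makes these
  entries admissible. Conversely, a merge inside a finite strongly convex \<open>M\<close> adds only
  pairs from \<open>M x M\<close>.\<close>

lemma almost_upper_triangular_iff:
  "almost_upper_triangular r a \<longleftrightarrow> (\<exists>L. finite L \<and> upper_triangular (preord_merge r L) a)"
proof
  assume "almost_upper_triangular r a"
  then have fin: "finite {(i, j). \<not> r i j \<and> a (i, j) \<noteq> 0}" (is "finite ?D")
    by (simp add: almost_upper_triangular_def)
  let ?L = "fst ` ?D \<union> snd ` ?D"
  have "i \<in> ?L \<and> j \<in> ?L" if "\<not> r i j" "a (i, j) \<noteq> 0" for i j
    using that by force
  then have "upper_triangular (preord_merge r ?L) a"
    unfolding upper_triangular_def merge_iff by (meson r_refl)
  moreover have "finite ?L"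
    using fin by simp
  ultimately show "\<exists>L. finite L \<and> upper_triangular (preord_merge r L) a"
    by (intro exI[of _ ?L] conjI)
next
  assume "\<exists>L. finite L \<and> upper_triangular (preord_merge r L) a"
  then obtain L where L: "finite L" "upper_triangular (preord_merge r L) a"
    by blast
  obtain M where M: "finite M" "strongly_convex r M" "L \<subseteq> M"
    using sconvex_hull[OF L(1)] .
  have "{(i, j). \<not> r i j \<and> a (i, j) \<noteq> 0} \<subseteq> M \<times> M"
    using merge_imp_in_sconvex[OF M(2,3)] L(2) by (auto simp: upper_triangular_def)
  then show "almost_upper_triangular r a"
    unfolding almost_upper_triangular_def using M(1) by (meson finite_SigmaI finite_subset)
qed

text \<open>Puts finitely many matrices into one common triangular setting; \<open>A\<close> forces
  prescribed indices into the merged set.\<close>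

lemma upper_triangular_merge_common:
  assumes "finite X" "\<And>x. x \<in> X \<Longrightarrow> almost_upper_triangular r x" "finite A"
  shows "\<exists>L. finite L \<and> strongly_convex r L \<and> A \<subseteq> L \<and>
    (\<forall>x\<in>X. upper_triangular (preord_merge r L) x)"
proof -
  have "\<exists>K. finite K \<and> upper_triangular (preord_merge r K) x" if "x \<in> X" for x
    using assms(2)[OF that] almost_upper_triangular_iff by blast
  then obtain K where K: "\<And>x. x \<in> X \<Longrightarrow> finite (K x) \<and> upper_triangular (preord_merge r (K x)) x"
    by metis
  then have "finite ((\<Union>x\<in>X. K x) \<union> A)"
    using assms(1,3) by auto
  then obtain L where L: "finite L" "strongly_convex r L" "(\<Union>x\<in>X. K x) \<union> A \<subseteq> L"
    by (rule sconvex_hull)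
  have "upper_triangular (preord_merge r L) x" if "x \<in> X" for x
  proof (rule upper_triangular_merge_mono[OF reflp transp])
    show "K x \<subseteq> L"
      using L(3) that by blast
  qed (use K[OF that] in blast)
  with L show ?thesis
    by (intro exI[of _ L]) simp
qed

section \<open>Identity, products and inverses in the group\<close>

lemma imat_one_AU: "(imat_one :: ('i, 'r::comm_ring_1) imat) \<in> AU_set r"
proof -
  interpret fh: finite_hull_preorder "preord_merge r {}"
    by (simp add: finite_hull_preorder_merge)
  have "nonsingular (preord_merge r {}) (imat_one :: ('i, 'r) imat)"
    using fh.upper_triangular_one by (intro fh.nonsingular_of_inverse) auto
  then show ?thesis
    using fh.upper_triangular_one nonsingular_merge[of "{}"] almost_upper_triangular_iff
    by (auto simp: AU_set_def)
qed

lemma AU_I: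
  assumes "almost_upper_triangular r a" "almost_upper_triangular r b"
    "imat_mult a b = imat_one" "imat_mult b a = imat_one"
  shows "a \<in> AU_set r"
proof -
  obtain L where L: "finite L" "upper_triangular (preord_merge r L) a"
    "upper_triangular (preord_merge r L) b"
    using upper_triangular_merge_common[of "{a, b}" "{}"] assms(1,2) by auto
  interpret finite_hull_preorder "preord_merge r L"
    using L finite_hull_preorder_merge by blast
  show ?thesis
    using nonsingular_of_inverse[OF L(2,3) assms(3,4)] nonsingular_merge[OF L(1)] assms(1)
    by (auto simp: AU_set_def)
qed

lemma AU_inverse:
  fixes a :: "('i, 'r::{comm_ring_1, finite}) imat"
  assumes "a \<in> AU_set r" "finite L" "upper_triangular (preord_merge r L) a"
  shows "\<exists>b. upper_triangular (preord_merge r L) b \<and> imat_mult a b = imat_one \<and> imat_mult b a = imat_one"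
proof -
  interpret finite_hull_preorder "preord_merge r L"
    using assms finite_hull_preorder_merge by blast
  show ?thesis
    using upper_triangular_inverse[OF assms(3)] nonsingular_merge[OF assms(2)] assms(1)
    by (auto simp: AU_set_def)
qed

lemma almost_upper_triangular_mult:
  assumes "almost_upper_triangular r a" "almost_upper_triangular r b"
  shows "almost_upper_triangular r (imat_mult a b)"
proof -
  obtain L where L: "finite L" "upper_triangular (preord_merge r L) a"
    "upper_triangular (preord_merge r L) b"
    using upper_triangular_merge_common[of "{a, b}" "{}"] assms(1,2) by auto
  then show ?thesis
    using finite_hull_preorder.upper_triangular_mult[OF finite_hull_preorder_merge]
      almost_upper_triangular_iff by blast
qed

lemma almost_upper_triangular_mult_assoc:
  assumes "almost_upper_triangular r a" "almost_upper_triangular r b" "almost_upper_triangular r c"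
  shows "imat_mult (imat_mult a b) c = imat_mult a (imat_mult b c)"
proof -
  obtain L where L: "finite L" "upper_triangular (preord_merge r L) a"
    "upper_triangular (preord_merge r L) b" "upper_triangular (preord_merge r L) c"
    using upper_triangular_merge_common[of "{a, b, c}" "{}"] assms by auto
  then show ?thesis
    by (intro finite_hull_preorder.imat_mult_assoc[OF finite_hull_preorder_merge])
qed

lemma AU_almost_upper: "a \<in> AU_set r \<Longrightarrow> almost_upper_triangular r a"
  by (simp add: AU_set_def)

lemma AU_E:
  fixes a :: "('i, 'r::{comm_ring_1, finite}) imat"
  assumes "a \<in> AU_set r"
  obtains b where "b \<in> AU_set r" "imat_mult a b = imat_one" "imat_mult b a = imat_one"
proof -
  obtain L where L: "finite L" "upper_triangular (preord_merge r L) a"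
    using almost_upper_triangular_iff assms AU_almost_upper by blast
  then obtain b where b: "upper_triangular (preord_merge r L) b" "imat_mult a b = imat_one"
    "imat_mult b a = imat_one"
    using AU_inverse[OF assms] by blast
  then show ?thesis
    using AU_I[of b a] AU_almost_upper[OF assms] almost_upper_triangular_iff L(1) that by blast
qed

lemma imat_mult_inverse:
  assumes "almost_upper_triangular r a" "almost_upper_triangular r a'"
    "almost_upper_triangular r b" "almost_upper_triangular r b'"
    and inv: "imat_mult a a' = imat_one" "imat_mult b b' = imat_one"
  shows "imat_mult (imat_mult a b) (imat_mult b' a') = imat_one"
proof -
  have "imat_mult (imat_mult a b) (imat_mult b' a') = imat_mult a (imat_mult b (imat_mult b' a'))"
    using assms by (simp add: almost_upper_triangular_mult_assoc almost_upper_triangular_mult)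
  also have "imat_mult b (imat_mult b' a') = imat_mult (imat_mult b b') a'"
    using assms by (intro almost_upper_triangular_mult_assoc[symmetric])
  finally show ?thesis
    by (simp add: inv)
qed

lemma AU_mult:
  fixes a :: "('i, 'r::{comm_ring_1, finite}) imat"
  assumes "a \<in> AU_set r" "b \<in> AU_set r"
  shows "imat_mult a b \<in> AU_set r"
proof -
  obtain a' where a': "a' \<in> AU_set r" "imat_mult a a' = imat_one" "imat_mult a' a = imat_one"
    using AU_E[OF assms(1)] .
  obtain b' where b': "b' \<in> AU_set r" "imat_mult b b' = imat_one" "imat_mult b' b = imat_one"
    using AU_E[OF assms(2)] .
  note up = assms[THEN AU_almost_upper] a'(1)[THEN AU_almost_upper] b'(1)[THEN AU_almost_upper]
  show ?thesis
    using up imat_mult_inverse[OF up(1,3,2,4) a'(2) b'(2)] imat_mult_inverse[OF up(4,2,3,1) b'(3) a'(3)]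
    by (intro AU_I[of _ "imat_mult b' a'"] almost_upper_triangular_mult)
qed

lemma group_AU: "group (AU_group r :: ('i, 'r::{comm_ring_1, finite}) imat monoid)"
proof (rule groupI)
  fix x :: "('i, 'r) imat" assume "x \<in> carrier (AU_group r)"
  then show "\<exists>y\<in>carrier (AU_group r). y \<otimes>\<^bsub>AU_group r\<^esub> x = \<one>\<^bsub>AU_group r\<^esub>"
    using AU_E[of x] by (auto simp: AU_group_def)
qed (auto simp: AU_group_def imat_one_AU AU_mult almost_upper_triangular_mult_assoc AU_almost_upper)

lemma carrier_AU [simp]: "carrier (AU_group r) = AU_set r"
  and mult_AU [simp]: "x \<otimes>\<^bsub>AU_group r\<^esub> y = imat_mult x y"
  and one_AU [simp]: "\<one>\<^bsub>AU_group r\<^esub> = imat_one"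
  by (simp_all add: AU_group_def)

end

section \<open>The topology of the group\<close>

lemma openin_U_topology_iff:
  "openin (U_topology s :: ('i, 'r::comm_ring_1) imat topology) V \<longleftrightarrow>
    V \<subseteq> U_set s \<and> (\<forall>x\<in>V. \<exists>S. finite S \<and> (\<forall>y\<in>U_set s. (\<forall>p\<in>S. y p = x p) \<longrightarrow> y \<in> V))"
  (is "_ \<longleftrightarrow> ?R")
proof
  assume "openin (U_topology s) V"
  then obtain W where W: "openin (product_topology (\<lambda>_. discrete_topology UNIV) UNIV) W" "V = W \<inter> U_set s"
    by (auto simp: U_topology_def openin_subtopology)
  have "\<exists>S. finite S \<and> (\<forall>y\<in>U_set s. (\<forall>p\<in>S. y p = x p) \<longrightarrow> y \<in> V)" if "x \<in> V" for x
  proof -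
    have "x \<in> W" using that W by simp
    then obtain B :: "'i \<times> 'i \<Rightarrow> 'r set" where B: "finite {i. B i \<noteq> UNIV}" "x \<in> PiE UNIV B" "PiE UNIV B \<subseteq> W"
      using W(1) unfolding openin_product_topology_alt by auto
    have "y \<in> W" if "\<forall>p\<in>{i. B i \<noteq> UNIV}. y p = x p" for y
    proof -
      have "y p \<in> B p" for p
        using that B(2) by (cases "B p = UNIV"; cases p) (auto simp: PiE_iff)
      then show ?thesis
        using B(3) by (auto simp: PiE_iff)
    qed
    with B(1) W(2) show ?thesis by blast
  qed
  with W(2) show ?R by blast
next
  assume R: ?R
  let ?P = "product_topology (\<lambda>_. discrete_topology UNIV) UNIV :: ('i, 'r) imat topology"
  have nbhd: "openin (U_topology s) {y \<in> U_set s. \<forall>p\<in>S. y p = x p}"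
    if "finite S" for S and x :: "('i, 'r) imat"
  proof -
    let ?B = "\<lambda>p. if p \<in> S then {x p} else UNIV"
    have "finite {p. ?B p \<noteq> UNIV}"
      by (rule finite_subset[OF _ that]) auto
    then have "openin ?P (PiE UNIV ?B)"
      by (simp add: openin_PiE_gen)
    moreover have "{y \<in> U_set s. \<forall>p\<in>S. y p = x p} = PiE UNIV ?B \<inter> U_set s"
      by (auto simp: PiE_iff split: if_splits)
    ultimately show ?thesis
      unfolding U_topology_def openin_subtopology by blast
  qed
  have "\<exists>W. openin (U_topology s) W \<and> x \<in> W \<and> W \<subseteq> V" if "x \<in> V" for x
  proof -
    obtain S where S: "finite S" "\<forall>y\<in>U_set s. (\<forall>p\<in>S. y p = x p) \<longrightarrow> y \<in> V"
      using R \<open>x \<in> V\<close> by blast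
    let ?W = "{y \<in> U_set s. \<forall>p\<in>S. y p = x p}"
    have "V \<subseteq> U_set s"
      using R by blast
    then have "x \<in> ?W" "?W \<subseteq> V"
      using that S(2) by blast+
    with nbhd[OF S(1)] show ?thesis
      by blast
  qed
  then show "openin (U_topology s) V"
    by (subst openin_subopen) blast
qed

lemma topspace_U_topology [simp]: "topspace (U_topology s) = U_set s"
  by (simp add: U_topology_def)

text \<open>Read \<open>y\<close> as a point of the basic neighbourhood of \<open>x\<close> given by
  \<open>S\<close>: free are only the entries with \<open>r i j\<close> outside
  \<open>S\<close>.\<close>

definition agree_off :: "('i \<Rightarrow> 'i \<Rightarrow> bool) \<Rightarrow> ('i \<times> 'i) set \<Rightarrow> ('i, 'r) imat \<Rightarrow> ('i, 'r) imat \<Rightarrow> bool" where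
  "agree_off r S x y \<longleftrightarrow> (\<forall>i j. (i, j) \<in> S \<or> \<not> r i j \<longrightarrow> y (i, j) = x (i, j))"

text \<open>
  An almost upper triangular matrix has only finitely many nonzero entries below the diagonal, and
  these are kept fixed in a sufficiently small neighbourhood: it is open in some
  \<^term>\<open>U_set (preord_merge r L)\<close>.
\<close>

definition AU_nbhd_topology :: "('i \<Rightarrow> 'i \<Rightarrow> bool) \<Rightarrow> ('i, 'r::comm_ring_1) imat topology" where
  "AU_nbhd_topology r = topology (\<lambda>V. V \<subseteq> AU_set r \<and>
     (\<forall>x\<in>V. \<exists>S. finite S \<and> (\<forall>y\<in>AU_set r. agree_off r S x y \<longrightarrow> y \<in> V)))"

lemma agree_off_refl: "agree_off r S x x"
  by (simp add: agree_off_def)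

lemma agree_off_trans: "agree_off r S x y \<Longrightarrow> agree_off r S y z \<Longrightarrow> agree_off r S x z"
  by (simp add: agree_off_def)

lemma agree_off_mono: "agree_off r S x y \<Longrightarrow> S' \<subseteq> S \<Longrightarrow> agree_off r S' x y"
  by (auto simp: agree_off_def)

lemma openin_AU_nbhd_topology:
  "openin (AU_nbhd_topology r :: ('a, 'b::comm_ring_1) imat topology) V \<longleftrightarrow> V \<subseteq> AU_set r \<and>
     (\<forall>x\<in>V. \<exists>S. finite S \<and> (\<forall>y\<in>AU_set r. agree_off r S x y \<longrightarrow> y \<in> V))"
proof -
  let ?P = "\<lambda>V :: ('a, 'b) imat set. V \<subseteq> AU_set r \<and>
     (\<forall>x\<in>V. \<exists>S. finite S \<and> (\<forall>y\<in>AU_set r. agree_off r S x y \<longrightarrow> y \<in> V))"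
  have "istopology ?P"
    unfolding istopology_def
  proof (intro conjI allI impI)
    fix V W :: "('a, 'b) imat set" assume *: "?P V" "?P W"
    show "V \<inter> W \<subseteq> AU_set r" using * by blast
    show "\<forall>x\<in>V \<inter> W. \<exists>S. finite S \<and> (\<forall>y\<in>AU_set r. agree_off r S x y \<longrightarrow> y \<in> V \<inter> W)"
    proof
      fix x assume "x \<in> V \<inter> W"
      with * obtain S S' where "finite S" "finite S'"
        "\<forall>y\<in>AU_set r. agree_off r S x y \<longrightarrow> y \<in> V" "\<forall>y\<in>AU_set r. agree_off r S' x y \<longrightarrow> y \<in> W"
        by blast
      then have "finite (S \<union> S')" "\<forall>y\<in>AU_set r. agree_off r (S \<union> S') x y \<longrightarrow> y \<in> V \<inter> W"
        using agree_off_mono[of r "S \<union> S'" x _ S] agree_off_mono[of r "S \<union> S'" x _ S'] by auto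
      then show "\<exists>S. finite S \<and> (\<forall>y\<in>AU_set r. agree_off r S x y \<longrightarrow> y \<in> V \<inter> W)"
        by (intro exI[of _ "S \<union> S'"] conjI)
    qed
  next
    fix \<K> :: "('a, 'b) imat set set" assume *: "\<forall>K\<in>\<K>. ?P K"
    then show "\<Union>\<K> \<subseteq> AU_set r" by blast
    show "\<forall>x\<in>\<Union>\<K>. \<exists>S. finite S \<and> (\<forall>y\<in>AU_set r. agree_off r S x y \<longrightarrow> y \<in> \<Union>\<K>)"
      using * by (meson UnionE UnionI)
  qed
  then show ?thesis
    by (simp add: AU_nbhd_topology_def topology_inverse')
qed

lemma topspace_AU_nbhd_topology [simp]: "topspace (AU_nbhd_topology r) = AU_set r"
proof -
  have "openin (AU_nbhd_topology r) (AU_set r)"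
    unfolding openin_AU_nbhd_topology by blast
  then show ?thesis
    by (metis openin_AU_nbhd_topology openin_subset openin_topspace subset_antisym)
qed

lemma openin_AU_nbhd:
  assumes "finite S"
  shows "openin (AU_nbhd_topology r) {y \<in> AU_set r. agree_off r S x y}"
  unfolding openin_AU_nbhd_topology using assms agree_off_trans by blast

section \<open>Continuity of multiplication and inversion\<close>

context Z_like_preorder
begin

lemma U_set_merge:
  assumes "finite L"
  shows "U_set (preord_merge r L) = {a \<in> AU_set r. upper_triangular (preord_merge r L) a}"
  unfolding U_set_def AU_set_def
  using nonsingular_merge[OF assms] almost_upper_triangular_iff assms by blast

lemma upper_triangular_agree_off:
  assumes "upper_triangular (preord_merge r M) x" "agree_off r S x y"
  shows "upper_triangular (preord_merge r M) y"
  unfolding upper_triangular_def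
proof (intro allI impI)
  fix i j assume *: "\<not> preord_merge r M i j"
  then have "\<not> r i j" using r_imp_merge by blast
  then have "y (i, j) = x (i, j)"
    using assms(2) by (simp add: agree_off_def)
  with * assms(1) show "y (i, j) = 0"
    by (simp add: upper_triangular_def)
qed

text \<open>A constrained entry outside the block on \<open>M\<close> is not in \<open>S\<close>,
  hence violates \<open>r\<close> and also the merged preorder; there both triangular matrices
  vanish.\<close>

lemma agree_offI:
  assumes "strongly_convex r M" "S \<subseteq> M \<times> M"
    and "upper_triangular (preord_merge r M) x" "upper_triangular (preord_merge r M) y"
    and "\<And>i j. i \<in> M \<Longrightarrow> j \<in> M \<Longrightarrow> y (i, j) = x (i, j)"
  shows "agree_off r S x y"
  unfolding agree_off_def
proof (intro allI impI)
  fix i j assume *: "(i, j) \<in> S \<or> \<not> r i j"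
  show "y (i, j) = x (i, j)"
  proof (cases "i \<in> M \<and> j \<in> M")
    case False
    with * assms(2) have "\<not> preord_merge r M i j"
      using merge_sconvex_iff[OF assms(1)] by blast
    with assms(3,4) show ?thesis
      by (simp add: upper_triangular_def)
  qed (use assms(5) in blast)
qed

lemma sconvex_hull_support:
  assumes "finite X" "\<And>x. x \<in> X \<Longrightarrow> almost_upper_triangular r x" "finite S"
  shows "\<exists>M. finite M \<and> strongly_convex r M \<and> S \<subseteq> M \<times> M \<and>
    (\<forall>x\<in>X. upper_triangular (preord_merge r M) x)"
proof -
  have fin: "finite (fst ` S \<union> snd ` S)"
    using assms(3) by simp
  obtain M where M: "finite M" "strongly_convex r M" "fst ` S \<union> snd ` S \<subseteq> M"
    "\<forall>x\<in>X. upper_triangular (preord_merge r M) x"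
    using upper_triangular_merge_common[OF assms(1,2) fin] by metis
  have "S \<subseteq> M \<times> M"
    using M(3) by force
  with M show ?thesis
    by blast
qed

text \<open>As \<open>M\<close> is convex for the merged preorder, the block of a product on
  \<open>M\<close> is the product of the blocks. Agreement on \<open>M x M\<close> therefore passes
  to products.\<close>

lemma agree_off_mult:
  fixes x y :: "('i, 'r::comm_ring_1) imat"
  assumes "almost_upper_triangular r x" "almost_upper_triangular r y" "finite S"
  shows "\<exists>S'. finite S' \<and> (\<forall>x' y'. agree_off r S' x x' \<and> agree_off r S' y y' \<longrightarrow>
    agree_off r S (imat_mult x y) (imat_mult x' y'))"
proof -
  obtain M where M: "finite M" "strongly_convex r M" "S \<subseteq> M \<times> M"
    and up: "upper_triangular (preord_merge r M) x" "upper_triangular (preord_merge r M) y"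
    using sconvex_hull_support[of "{x, y}" S] assms by auto
  interpret fh: finite_hull_preorder "preord_merge r M"
    using M finite_hull_preorder_merge by blast
  have conv: "preord_convex (preord_merge r M) M"
    using convex_merge sconvex_imp_convex[OF M(2)] by blast
  have "agree_off r S (imat_mult x y) (imat_mult x' y')"
    if ag: "agree_off r (M \<times> M) x x'" "agree_off r (M \<times> M) y y'" for x' y'
  proof (rule agree_offI[OF M(2,3)])
    note up' = upper_triangular_agree_off[OF up(1) ag(1)] upper_triangular_agree_off[OF up(2) ag(2)]
    show "upper_triangular (preord_merge r M) (imat_mult x y)"
      "upper_triangular (preord_merge r M) (imat_mult x' y')"
      using up up' fh.upper_triangular_mult by blast+
    fix i j assume ij: "i \<in> M" "j \<in> M"
    show "imat_mult x' y' (i, j) = imat_mult x y (i, j)"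
      using ag ij by (simp add: upper_triangular_mult_eq_sum[OF up M(1) conv]
          upper_triangular_mult_eq_sum[OF up' M(1) conv] agree_off_def)
  qed
  with M(1) show ?thesis
    by (intro exI[of _ "M \<times> M"]) auto
qed

lemma AU_inverse_unique:
  assumes "almost_upper_triangular r a" "almost_upper_triangular r b" "almost_upper_triangular r c"
    and "imat_mult b a = imat_one" "imat_mult a c = imat_one"
  shows "b = c"
  using almost_upper_triangular_mult_assoc[OF assms(2,1,3)] assms(4,5) by simp

lemma inv_AU:
  fixes x :: "('i, 'r::{comm_ring_1, finite}) imat"
  assumes "x \<in> AU_set r"
  shows "inv\<^bsub>AU_group r\<^esub> x \<in> AU_set r" "imat_mult x (inv\<^bsub>AU_group r\<^esub> x) = imat_one"
    "imat_mult (inv\<^bsub>AU_group r\<^esub> x) x = imat_one"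
  using group.inv_closed[OF group_AU] group.r_inv[OF group_AU] group.l_inv[OF group_AU] assms
  by auto

lemma upper_triangular_inv_AU:
  fixes x :: "('i, 'r::{comm_ring_1, finite}) imat"
  assumes "x \<in> AU_set r" "finite L" "upper_triangular (preord_merge r L) x"
  shows "upper_triangular (preord_merge r L) (inv\<^bsub>AU_group r\<^esub> x)"
proof -
  obtain b where b: "upper_triangular (preord_merge r L) b" "imat_mult x b = imat_one"
    using AU_inverse[OF assms] by blast
  then have "inv\<^bsub>AU_group r\<^esub> x = b"
    using AU_inverse_unique[of x "inv\<^bsub>AU_group r\<^esub> x" b] inv_AU[OF assms(1)] assms
      AU_almost_upper almost_upper_triangular_iff by blast
  with b(1) show ?thesis by simp
qed

text \<open>The block of the inverse on \<open>M\<close> is the inverse of the block, and a block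
  has only one inverse. Agreement on \<open>M x M\<close> therefore passes to inverses.\<close>

lemma agree_off_inv:
  fixes x :: "('i, 'r::{comm_ring_1, finite}) imat"
  assumes x: "x \<in> AU_set r" and "finite S"
  shows "\<exists>S'. finite S' \<and> (\<forall>y\<in>AU_set r. agree_off r S' x y \<longrightarrow>
    agree_off r S (inv\<^bsub>AU_group r\<^esub> x) (inv\<^bsub>AU_group r\<^esub> y))"
proof -
  obtain M where M: "finite M" "strongly_convex r M" "S \<subseteq> M \<times> M"
    and up: "upper_triangular (preord_merge r M) x"
    using sconvex_hull_support[of "{x}" S] assms AU_almost_upper by auto
  interpret fh: finite_hull_preorder "preord_merge r M"
    using M finite_hull_preorder_merge by blast
  have conv: "preord_convex (preord_merge r M) M"
    using convex_merge sconvex_imp_convex[OF M(2)] by blast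
  have "agree_off r S (inv\<^bsub>AU_group r\<^esub> x) (inv\<^bsub>AU_group r\<^esub> y)"
    if ag: "agree_off r (M \<times> M) x y" and y: "y \<in> AU_set r" for y
  proof (rule agree_offI[OF M(2,3)])
    note up' = upper_triangular_agree_off[OF up ag]
    show inv_up: "upper_triangular (preord_merge r M) (inv\<^bsub>AU_group r\<^esub> x)"
      "upper_triangular (preord_merge r M) (inv\<^bsub>AU_group r\<^esub> y)"
      using upper_triangular_inv_AU x y up up' M(1) by blast+
    have "inverse_on M x (inv\<^bsub>AU_group r\<^esub> x)"
      by (rule fh.inverse_on_of_inverse[OF up inv_up(1) inv_AU(2,3)[OF x] M(1) conv])
    moreover have "inverse_on M y (inv\<^bsub>AU_group r\<^esub> y)"
      by (rule fh.inverse_on_of_inverse[OF up' inv_up(2) inv_AU(2,3)[OF y] M(1) conv])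
    then have "inverse_on M x (inv\<^bsub>AU_group r\<^esub> y)"
      using ag by (subst inverse_on_cong) (auto simp: agree_off_def)
    moreover fix i j assume "i \<in> M" "j \<in> M"
    ultimately show "(inv\<^bsub>AU_group r\<^esub> y) (i, j) = (inv\<^bsub>AU_group r\<^esub> x) (i, j)"
      using inverse_on_unique[OF M(1)] by metis
  qed
  with M(1) show ?thesis
    by (intro exI[of _ "M \<times> M"]) auto
qed

lemma group_topology_AU_nbhd:
  "group_topology (AU_group r) (AU_nbhd_topology r :: ('i, 'r::{comm_ring_1, finite}) imat topology)"
  unfolding group_topology_def
proof (intro conjI)
  show "group (AU_group r :: ('i, 'r) imat monoid)"
    by (rule group_AU)
  show "topspace (AU_nbhd_topology r :: ('i, 'r) imat topology) = carrier (AU_group r)"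
    by simp
  let ?T = "AU_nbhd_topology r :: ('i, 'r) imat topology"
  show "continuous_map (prod_topology ?T ?T) ?T (\<lambda>(x, y). x \<otimes>\<^bsub>AU_group r\<^esub> y)"
    unfolding continuous_map_def
  proof (intro conjI allI impI)
    show "(\<lambda>(x, y). x \<otimes>\<^bsub>AU_group r\<^esub> y) \<in> topspace (prod_topology ?T ?T) \<rightarrow> topspace ?T"
      using AU_mult by auto
    fix V assume V: "openin ?T V"
    show "openin (prod_topology ?T ?T)
      {p \<in> topspace (prod_topology ?T ?T). (case p of (x, y) \<Rightarrow> x \<otimes>\<^bsub>AU_group r\<^esub> y) \<in> V}"
      unfolding openin_prod_topology_alt
    proof (intro allI impI)
      fix x y
      assume "(x, y) \<in> {p \<in> topspace (prod_topology ?T ?T). (case p of (x, y) \<Rightarrow> x \<otimes>\<^bsub>AU_group r\<^esub> y) \<in> V}"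
      then have xy: "x \<in> AU_set r" "y \<in> AU_set r" "imat_mult x y \<in> V"
        by auto
      then obtain S where S: "finite S" "\<forall>z\<in>AU_set r. agree_off r S (imat_mult x y) z \<longrightarrow> z \<in> V"
        using V by (auto simp: openin_AU_nbhd_topology)
      obtain S' where S': "finite S'" "\<forall>x' y'. agree_off r S' x x' \<and> agree_off r S' y y' \<longrightarrow>
          agree_off r S (imat_mult x y) (imat_mult x' y')"
        using agree_off_mult[OF AU_almost_upper[OF xy(1)] AU_almost_upper[OF xy(2)] S(1)] by blast
      let ?N = "\<lambda>x. {x' \<in> AU_set r. agree_off r S' x x'}"
      have "?N x \<times> ?N y \<subseteq> {p \<in> topspace (prod_topology ?T ?T). (case p of (x, y) \<Rightarrow> x \<otimes>\<^bsub>AU_group r\<^esub> y) \<in> V}"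
        using S(2) S'(2) AU_mult by (auto intro!: S(2)[rule_format])
      moreover have "openin ?T (?N x)" "openin ?T (?N y)" "x \<in> ?N x" "y \<in> ?N y"
        using openin_AU_nbhd[OF S'(1)] xy agree_off_refl by blast+
      ultimately show "\<exists>U V'. openin ?T U \<and> openin ?T V' \<and> x \<in> U \<and> y \<in> V' \<and>
        U \<times> V' \<subseteq> {p \<in> topspace (prod_topology ?T ?T). (case p of (x, y) \<Rightarrow> x \<otimes>\<^bsub>AU_group r\<^esub> y) \<in> V}"
        by blast
    qed
  qed
  show "continuous_map ?T ?T (\<lambda>x. inv\<^bsub>AU_group r\<^esub> x)"
    unfolding continuous_map_def
  proof (intro conjI allI impI)
    show "(\<lambda>x. inv\<^bsub>AU_group r\<^esub> x) \<in> topspace ?T \<rightarrow> topspace ?T"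
      using inv_AU by auto
    fix V assume V: "openin ?T V"
    have "\<exists>S'. finite S' \<and> (\<forall>y\<in>AU_set r. agree_off r S' x y \<longrightarrow> inv\<^bsub>AU_group r\<^esub> y \<in> V)"
      if "x \<in> AU_set r" "inv\<^bsub>AU_group r\<^esub> x \<in> V" for x
    proof -
      obtain S where S: "finite S" "\<forall>z\<in>AU_set r. agree_off r S (inv\<^bsub>AU_group r\<^esub> x) z \<longrightarrow> z \<in> V"
        using V \<open>inv\<^bsub>AU_group r\<^esub> x \<in> V\<close> by (auto simp: openin_AU_nbhd_topology)
      then show ?thesis
        using agree_off_inv[OF \<open>x \<in> AU_set r\<close> S(1)] inv_AU(1) by blast
    qed
    then show "openin ?T {x \<in> topspace ?T. inv\<^bsub>AU_group r\<^esub> x \<in> V}"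
      by (auto simp: openin_AU_nbhd_topology)
  qed
qed

text \<open>Inside \<open>U_set (preord_merge r L)\<close> the entries that violate \<open>r\<close>
  can be nonzero only in the finite square on \<open>M\<close>. Fixing that square fixes all of
  them, so the product topology and the neighbourhood topology coincide there.\<close>

lemma openin_U_merge_iff:
  fixes V :: "('i, 'r::comm_ring_1) imat set"
  assumes "finite L"
  shows "openin (U_topology (preord_merge r L)) V \<longleftrightarrow>
    V \<subseteq> U_set (preord_merge r L) \<and> openin (AU_nbhd_topology r) V"
proof (cases "V \<subseteq> U_set (preord_merge r L)")
  case True
  obtain M where M: "finite M" "strongly_convex r M" "L \<subseteq> M"
    using sconvex_hull[OF assms] .
  have U: "U_set (preord_merge r L) = {a \<in> AU_set r. upper_triangular (preord_merge r L) a}"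
    by (rule U_set_merge[OF assms])
  have "(\<exists>S. finite S \<and> (\<forall>y\<in>U_set (preord_merge r L). (\<forall>p\<in>S. y p = x p) \<longrightarrow> y \<in> V)) \<longleftrightarrow>
    (\<exists>S. finite S \<and> (\<forall>y\<in>AU_set r. agree_off r S x y \<longrightarrow> y \<in> V))" if "x \<in> V" for x
  proof
    assume "\<exists>S. finite S \<and> (\<forall>y\<in>U_set (preord_merge r L). (\<forall>p\<in>S. y p = x p) \<longrightarrow> y \<in> V)"
    then obtain S where S: "finite S" "\<forall>y\<in>U_set (preord_merge r L). (\<forall>p\<in>S. y p = x p) \<longrightarrow> y \<in> V"
      by blast
    have "y \<in> V" if "y \<in> AU_set r" "agree_off r S x y" for y
    proof -
      have "y \<in> U_set (preord_merge r L)"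
        using that upper_triangular_agree_off[of L x S y] True \<open>x \<in> V\<close> U by blast
      moreover have "\<forall>p\<in>S. y p = x p"
        using that(2) by (auto simp: agree_off_def)
      ultimately show ?thesis
        using S(2) by blast
    qed
    with S(1) show "\<exists>S. finite S \<and> (\<forall>y\<in>AU_set r. agree_off r S x y \<longrightarrow> y \<in> V)"
      by blast
  next
    assume "\<exists>S. finite S \<and> (\<forall>y\<in>AU_set r. agree_off r S x y \<longrightarrow> y \<in> V)"
    then obtain S where S: "finite S" "\<forall>y\<in>AU_set r. agree_off r S x y \<longrightarrow> y \<in> V"
      by blast
    have "y \<in> V" if y: "y \<in> U_set (preord_merge r L)" "\<forall>p\<in>S \<union> M \<times> M. y p = x p" for y
    proof -
      have "y (i, j) = x (i, j)" if "\<not> r i j" for i j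
      proof (cases "i \<in> M \<and> j \<in> M")
        case False
        then have "\<not> preord_merge r L i j"
          using merge_imp_in_sconvex[OF M(2,3)] that by blast
        then show ?thesis
          using y(1) \<open>x \<in> V\<close> subsetD[OF True] by (simp add: U upper_triangular_def)
      qed (use y(2) in blast)
      then have "agree_off r S x y"
        using y(2) by (auto simp: agree_off_def)
      then show ?thesis
        using S(2) y(1) U by blast
    qed
    then show "\<exists>S. finite S \<and> (\<forall>y\<in>U_set (preord_merge r L). (\<forall>p\<in>S. y p = x p) \<longrightarrow> y \<in> V)"
      using S(1) M(1) by (intro exI[of _ "S \<union> M \<times> M"] conjI ballI impI) simp_all
  qed
  moreover have "V \<subseteq> AU_set r"
    using True U by blast
  ultimately show ?thesis
    using True by (simp add: openin_U_topology_iff openin_AU_nbhd_topology)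
qed (auto simp: openin_U_topology_iff)

section \<open>Existence and uniqueness of the group topology\<close>

lemma openin_U_set_merge:
  assumes "finite L"
  shows "openin (AU_nbhd_topology r) (U_set (preord_merge r L) :: ('i, 'r::comm_ring_1) imat set)"
  using openin_U_merge_iff[OF assms, of "U_set (preord_merge r L) :: ('i, 'r) imat set"]
    openin_topspace[of "U_topology (preord_merge r L) :: ('i, 'r) imat topology"] by simp

lemma is_AU_topology_AU_nbhd:
  "is_AU_topology r (AU_nbhd_topology r :: ('i, 'r::{comm_ring_1, finite}) imat topology)"
  unfolding is_AU_topology_def
proof (intro conjI allI impI group_topology_AU_nbhd)
  let ?T = "AU_nbhd_topology r :: ('i, 'r) imat topology"
  fix L :: "'i set" assume "finite L \<and> preord_convex r L"
  then have L: "finite L" by simp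
  let ?U = "U_topology (preord_merge r L) :: ('i, 'r) imat topology"
  show "continuous_map ?U ?T (\<lambda>a. a)"
    unfolding continuous_map_def
  proof (intro conjI allI impI)
    show "(\<lambda>a. a) \<in> topspace ?U \<rightarrow> topspace ?T"
      using U_set_merge[OF L] by auto
    fix V assume "openin ?T V"
    then show "openin ?U {x \<in> topspace ?U. x \<in> V}"
      using openin_U_set_merge[OF L] by (auto simp: openin_U_merge_iff[OF L] Collect_conj_eq)
  qed
  show "open_map ?U ?T (\<lambda>a. a)"
    by (auto simp: open_map_def openin_U_merge_iff[OF L])
qed

text \<open>Each point of \<open>V\<close> lies in some \<open>U_set (preord_merge r L)\<close>. The
  part of \<open>V\<close> in that subgroup is open in it, because its inclusion is continuous for
  \<open>T\<close>, and then open in \<open>T'\<close>, because its inclusion is open for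
  \<open>T'\<close>. Exchanging \<open>T\<close> and \<open>T'\<close> gives uniqueness.\<close>

lemma is_AU_topology_unique:
  fixes T T' :: "('i, 'r::comm_ring_1) imat topology"
  assumes "is_AU_topology r T" "is_AU_topology r T'" "openin T V"
  shows "openin T' V"
proof -
  have "\<exists>W. openin T' W \<and> x \<in> W \<and> W \<subseteq> V" if "x \<in> V" for x
  proof -
    have "x \<in> AU_set r"
      using openin_subset[OF assms(3)] that assms(1)
      by (auto simp: is_AU_topology_def group_topology_def)
    then obtain L where L: "finite L" "strongly_convex r L" "upper_triangular (preord_merge r L) x"
      using sconvex_hull_support[of "{x}" "{}"] AU_almost_upper by auto
    let ?U = "U_topology (preord_merge r L) :: ('i, 'r) imat topology"
    let ?W = "{y \<in> topspace ?U. y \<in> V}"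
    have "openin ?U ?W"
      using assms(1,3) L sconvex_imp_convex
      by (auto simp: is_AU_topology_def continuous_map_def simp del: topspace_U_topology)
    then have "openin T' ?W"
      using assms(2) L sconvex_imp_convex
      by (auto simp: is_AU_topology_def open_map_def)
    moreover have "x \<in> ?W"
      using that L \<open>x \<in> AU_set r\<close> U_set_merge by auto
    ultimately show ?thesis by blast
  qed
  then show ?thesis
    by (subst openin_subopen) blast
qed

lemma AU_topology_eq:
  "(AU_topology r :: ('i, 'r::{comm_ring_1, finite}) imat topology) = AU_nbhd_topology r"
  unfolding AU_topology_def
proof (rule the_equality)
  show "is_AU_topology r (AU_nbhd_topology r :: ('i, 'r) imat topology)"
    by (rule is_AU_topology_AU_nbhd)
  fix T :: "('i, 'r) imat topology" assume "is_AU_topology r T"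
  then show "T = AU_nbhd_topology r"
    unfolding topology_eq using is_AU_topology_unique is_AU_topology_AU_nbhd by blast
qed

end

section \<open>Matrices that differ from the identity in one column\<close>

text \<open>The identity plus the column \<open>a\<close> times the unit row \<open>e_m\<close>.
  Elementary matrices, diagonal matrices with one altered entry and the pivot steps of Gaussian
  elimination are all of this form.\<close>

definition col_mat :: "('i \<Rightarrow> 'r) \<Rightarrow> 'i \<Rightarrow> ('i, 'r::comm_ring_1) imat" where
  "col_mat a m = (\<lambda>(p, q). imat_one (p, q) + (if q = m then a p else 0))"

definition elem_mat :: "'i \<Rightarrow> 'i \<Rightarrow> 'r \<Rightarrow> ('i, 'r::comm_ring_1) imat" where
  "elem_mat i j c = col_mat (\<lambda>p. if p = i then c else 0) j"

text \<open>Each row of \<open>col_mat a m\<close> has at most two nonzero entries, so multiplying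
  from the left is a row operation on any \<open>X\<close>. Multiplying from the right sums over a
  column, hence the finite support \<open>K\<close> there.\<close>

lemma col_mat_mult_left:
  "imat_mult (col_mat a m) X (p, q) = X (p, q) + a p * X (m, q)"
proof (cases "p = m")
  case True
  then show ?thesis
    by (subst imat_mult_eq_sum[of "{m}"]) (auto simp: col_mat_def imat_one_def algebra_simps)
next
  case False
  then show ?thesis
    by (subst imat_mult_eq_sum[of "{p, m}"]) (auto simp: col_mat_def imat_one_def)
qed

lemma col_mat_mult_right:
  assumes "finite K" "\<And>k. k \<notin> K \<Longrightarrow> a k = 0"
  shows "imat_mult X (col_mat a m) (p, q)
    = X (p, q) + (if q = m then \<Sum>k\<in>K. X (p, k) * a k else 0)"
proof -
  have "imat_mult X (col_mat a m) (p, q) = (\<Sum>k\<in>insert q K. X (p, k) * col_mat a m (k, q))"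
    using assms by (intro imat_mult_eq_sum) (auto simp: col_mat_def imat_one_def)
  also have "\<dots> = (\<Sum>k\<in>insert q K. if k = q then X (p, k) else 0)
      + (\<Sum>k\<in>insert q K. if q = m then X (p, k) * a k else 0)"
    by (subst sum.distrib[symmetric], intro sum.cong)
      (auto simp: col_mat_def imat_one_def algebra_simps)
  also have "(\<Sum>k\<in>insert q K. if k = q then X (p, k) else 0) = X (p, q)"
    using assms(1) by simp
  also have "(\<Sum>k\<in>insert q K. if q = m then X (p, k) * a k else 0)
      = (if q = m then \<Sum>k\<in>K. X (p, k) * a k else 0)"
    using assms by (auto intro!: sum.mono_neutral_right)
  finally show ?thesis .
qed

lemma elem_mat_mult_left:
  "imat_mult (elem_mat i j c) X (p, q) = X (p, q) + (if p = i then c * X (j, q) else 0)"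
  by (simp add: elem_mat_def col_mat_mult_left)

lemma elem_mat_mult_right:
  "imat_mult X (elem_mat i j c) (p, q) = X (p, q) + (if q = j then X (p, i) * c else 0)"
  unfolding elem_mat_def by (subst col_mat_mult_right[of "{i}"]) auto

lemma elem_mat_apply:
  "elem_mat i j c (p, q) = (if p = q then 1 else 0) + (if p = i \<and> q = j then c else 0)"
  by (simp add: elem_mat_def col_mat_def imat_one_def)

lemma col_mat_mult_col_mat:
  "imat_mult (col_mat a m) (col_mat b m) = col_mat (\<lambda>p. a p + b p + a p * b m) m"
  by (rule ext, clarify, subst col_mat_mult_left)
    (auto simp: col_mat_def imat_one_def algebra_simps)

lemma col_mat_0: "(\<And>p. a p = 0) \<Longrightarrow> col_mat a m = imat_one"
  by (auto simp: col_mat_def)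

context Z_like_preorder
begin

lemma almost_upper_triangular_col_mat:
  assumes "finite {k. a k \<noteq> 0}"
  shows "almost_upper_triangular r (col_mat a m)"
  unfolding almost_upper_triangular_def
  by (rule finite_subset[of _ "{k. a k \<noteq> 0} \<times> {m}"])
    (use assms in \<open>auto simp: col_mat_def imat_one_def split: if_splits\<close>)

text \<open>Solving \<open>a p + b p + a p * b m = 0\<close> first at \<open>p = m\<close> gives
  \<open>1 + b m = 1 / (1 + a m)\<close>, hence \<open>b p = - a p / (1 + a m)\<close>.\<close>

lemma col_mat_inverse:
  fixes a :: "'i \<Rightarrow> 'f::field"
  assumes "1 + a m \<noteq> 0"
  shows "imat_mult (col_mat a m) (col_mat (\<lambda>p. - a p / (1 + a m)) m) = imat_one"
    and "imat_mult (col_mat (\<lambda>p. - a p / (1 + a m)) m) (col_mat a m) = imat_one"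
  unfolding col_mat_mult_col_mat using assms by (auto intro!: col_mat_0 simp: divide_simps) algebra+

lemma col_mat_AU:
  fixes a :: "'i \<Rightarrow> 'f::field"
  assumes "1 + a m \<noteq> 0" "finite {k. a k \<noteq> 0}"
  shows "col_mat a m \<in> AU_set r"
proof (rule AU_I[OF _ _ col_mat_inverse[of a m, OF assms(1)]])
  show "almost_upper_triangular r (col_mat a m)"
    using assms(2) by (rule almost_upper_triangular_col_mat)
  have "{k. - a k / (1 + a m) \<noteq> 0} = {k. a k \<noteq> 0}"
    using assms(1) by auto
  then show "almost_upper_triangular r (col_mat (\<lambda>p. - a p / (1 + a m)) m)"
    using assms(2) by (intro almost_upper_triangular_col_mat) simp
qed

lemma elem_mat_AU:
  fixes c :: "'f::field"
  assumes "i \<noteq> j"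
  shows "elem_mat i j c \<in> AU_set r"
  unfolding elem_mat_def
  by (rule col_mat_AU) (use assms in \<open>auto intro: finite_subset[of _ "{i}"]\<close>)

text \<open>The product is defined at every entry, so the default value 0 of \<open>Sum_any\<close>
  never enters and the sums may be split additively.\<close>

lemma finite_imat_mult_support:
  assumes "almost_upper_triangular r x" "almost_upper_triangular r y"
  shows "finite {k. x (p, k) * y (k, q) \<noteq> 0}"
proof -
  obtain M where M: "finite M" "strongly_convex r M" "{(p, q)} \<subseteq> M \<times> M"
    and up: "upper_triangular (preord_merge r M) x" "upper_triangular (preord_merge r M) y"
    using sconvex_hull_support[of "{x, y}" "{(p, q)}"] assms by auto
  have "preord_convex (preord_merge r M) M"
    using convex_merge sconvex_imp_convex[OF M(2)] by blast
  then have "{k. x (p, k) * y (k, q) \<noteq> 0} \<subseteq> M"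
    using upper_triangular_mult_eq_0[OF up] preord_convexD[of _ M p q] M(3) by blast
  then show ?thesis
    using M(1) finite_subset by blast
qed

text \<open>Expands \<open>x (1 + a e_m) y = x y + (x a) (e_m y)\<close>, a rank one perturbation of
  the identity.\<close>

lemma col_mat_conj:
  assumes "almost_upper_triangular r x" "almost_upper_triangular r y" "imat_mult x y = imat_one"
    and "finite K" "\<And>k. k \<notin> K \<Longrightarrow> a k = 0"
  shows "imat_mult (imat_mult x (col_mat a m)) y (p, q)
    = imat_one (p, q) + (\<Sum>k\<in>K. x (p, k) * a k) * y (m, q)"
proof -
  let ?s = "\<Sum>k\<in>K. x (p, k) * a k"
  have "imat_mult (imat_mult x (col_mat a m)) y (p, q)
      = Sum_any (\<lambda>l. x (p, l) * y (l, q) + (if l = m then ?s * y (m, q) else 0))"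
    unfolding imat_mult_def[of "imat_mult x (col_mat a m)" y]
    by (simp, rule Sum_any.cong)
      (simp add: col_mat_mult_right[OF assms(4,5)] distrib_right)
  also have "\<dots> = Sum_any (\<lambda>l. x (p, l) * y (l, q)) + Sum_any (\<lambda>l. if l = m then ?s * y (m, q) else 0)"
    using finite_imat_mult_support[OF assms(1,2)] by (intro Sum_any.distrib) auto
  also have "Sum_any (\<lambda>l. x (p, l) * y (l, q)) = imat_one (p, q)"
    using fun_cong[OF assms(3), of "(p, q)"] by (simp add: imat_mult_def)
  finally show ?thesis
    by simp
qed

end

section \<open>Closed normal subgroups\<close>

locale AU_normal_subgroup = Z_like_preorder r for r :: "'i \<Rightarrow> 'i \<Rightarrow> bool" +
  fixes N :: "('i, 'f::{field, finite}) imat set"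
  assumes infinite_UNIV: "infinite (UNIV :: 'i set)"
    and normal: "N \<lhd> AU_group r"
begin

section \<open>Commutators in a normal subgroup\<close>

sublocale G: group "AU_group r :: ('i, 'f) imat monoid"
  by (rule group_AU)

lemma fresh_index:
  assumes "finite (A :: 'i set)"
  obtains i where "i \<notin> A"
  using ex_new_if_finite[OF infinite_UNIV assms] by blast

lemma N_AU: "x \<in> N \<Longrightarrow> x \<in> AU_set r"
  using normal.axioms(1)[OF normal] subgroup.mem_carrier by fastforce

lemma N_mult: "x \<in> N \<Longrightarrow> y \<in> N \<Longrightarrow> imat_mult x y \<in> N"
  using normal.axioms(1)[OF normal] subgroup.m_closed by fastforce

lemma N_one: "imat_one \<in> N"
  using normal.axioms(1)[OF normal] subgroup.one_closed by fastforce

lemma commutator_in_N: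
  assumes "n \<in> N" "g \<in> AU_set r"
  shows "imat_mult (imat_mult (imat_mult n g) (inv\<^bsub>AU_group r\<^esub> n)) (inv\<^bsub>AU_group r\<^esub> g) \<in> N"
proof -
  have "inv\<^bsub>AU_group r\<^esub> n \<in> N"
    using assms(1) normal.axioms(1)[OF normal] by (simp add: subgroup.m_inv_closed)
  then have "imat_mult (imat_mult g (inv\<^bsub>AU_group r\<^esub> n)) (inv\<^bsub>AU_group r\<^esub> g) \<in> N"
    using normal.inv_op_closed2[OF normal, of g] assms(2) by simp
  then have "imat_mult n (imat_mult (imat_mult g (inv\<^bsub>AU_group r\<^esub> n)) (inv\<^bsub>AU_group r\<^esub> g)) \<in> N"
    using assms(1) N_mult by blast
  also have "imat_mult n (imat_mult (imat_mult g (inv\<^bsub>AU_group r\<^esub> n)) (inv\<^bsub>AU_group r\<^esub> g))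
      = imat_mult (imat_mult (imat_mult n g) (inv\<^bsub>AU_group r\<^esub> n)) (inv\<^bsub>AU_group r\<^esub> g)"
    using G.m_assoc[of n g "inv\<^bsub>AU_group r\<^esub> n"]
      G.m_assoc[of n "imat_mult g (inv\<^bsub>AU_group r\<^esub> n)" "inv\<^bsub>AU_group r\<^esub> g"]
      assms(2) N_AU[OF assms(1)] by (simp add: inv_AU(1) AU_mult)
  finally show ?thesis .
qed

text \<open>The relation says \<open>h = n g n^-1 g^-1\<close>. In this form a commutator can be
  verified by row and column operations, without computing inverses.\<close>

lemma commutator_relation:
  assumes "n \<in> N" "g \<in> AU_set r" "h \<in> AU_set r" "imat_mult n g = imat_mult h (imat_mult g n)"
  shows "h \<in> N"
proof -
  have n: "n \<in> AU_set r" using assms N_AU by blast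
  have "imat_mult (imat_mult (imat_mult n g) (inv\<^bsub>AU_group r\<^esub> n)) (inv\<^bsub>AU_group r\<^esub> g) = h"
    using G.m_assoc[of h g n] G.m_assoc[of "imat_mult h g" n "inv\<^bsub>AU_group r\<^esub> n"]
      G.m_assoc[of h g "inv\<^bsub>AU_group r\<^esub> g"] n assms(2,3)
    by (simp add: assms(4) inv_AU AU_mult)
  then show ?thesis
    using commutator_in_N[OF assms(1,2)] by simp
qed

text \<open>Here \<open>h = g n g^-1 n^-1\<close>, the inverse of the commutator of \<open>n\<close>
  and \<open>g\<close>.\<close>

lemma commutator_relation':
  assumes "n \<in> N" "g \<in> AU_set r" "h \<in> AU_set r" "imat_mult g n = imat_mult h (imat_mult n g)"
  shows "h \<in> N"
proof -
  have n: "n \<in> AU_set r" using assms N_AU by blast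
  let ?k = "inv\<^bsub>AU_group r\<^esub> h"
  have "imat_mult n g = imat_mult ?k (imat_mult g n)"
    using assms n G.inv_solve_left[of "imat_mult n g" h "imat_mult g n"] by (simp add: AU_mult)
  then have "?k \<in> N"
    using commutator_relation[OF assms(1,2)] inv_AU(1)[OF assms(3)] by blast
  then show ?thesis
    using normal.axioms(1)[OF normal] subgroup.m_inv_closed G.inv_inv assms(3)
    by (metis carrier_AU)
qed

lemma N_cancel_left:
  assumes "x \<in> AU_set r" "g \<in> N" "imat_mult g x \<in> N"
  shows "x \<in> N"
proof -
  have "x = imat_mult (inv\<^bsub>AU_group r\<^esub> g) (imat_mult g x)"
    using assms(1) N_AU[OF assms(2)] G.inv_solve_left[of x g "imat_mult g x"] by (simp add: AU_mult)
  moreover have "inv\<^bsub>AU_group r\<^esub> g \<in> N"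
    using assms(2) normal.axioms(1)[OF normal] by (simp add: subgroup.m_inv_closed)
  ultimately show ?thesis
    using assms(3) N_mult by metis
qed

section \<open>From a nonscalar element to an elementary matrix\<close>

lemma commutes_with_elem_mats_imp_scalar:
  fixes x :: "('i, 'f) imat"
  assumes "\<And>i j. i \<noteq> j \<Longrightarrow> imat_mult x (elem_mat i j 1) = imat_mult (elem_mat i j 1) x"
  shows "scalar_imat x"
proof -
  \<comment> \<open>After cancelling \<open>x\<close> on both sides, column \<open>i\<close> moved
    to column \<open>j\<close> is compared with row \<open>j\<close> moved to row
    \<open>i\<close>.\<close>
  have *: "(if q = j then x (p, i) else 0) = (if p = i then x (j, q) else 0)" if "i \<noteq> j" for i j p q
    using fun_cong[OF assms[OF that], of "(p, q)"]
    by (simp add: elem_mat_mult_left elem_mat_mult_right split: if_splits)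
  have "x (p, i) = 0" if "p \<noteq> i" for p i
    using *[of i p p p] that by simp
  moreover have "x (i, i) = x (j, j)" for i j
    using *[of i j j i] by (cases "i = j") auto
  ultimately show ?thesis
    unfolding scalar_imat_def by metis
qed

text \<open>For an elementary \<open>g\<close> at \<open>(i, j)\<close>, \<open>x g x^-1\<close> is
  the identity plus column \<open>i\<close> of \<open>x\<close> times row \<open>j\<close> of
  \<open>x^-1\<close>; the factor \<open>g^-1\<close> on the right disturbs only column
  \<open>j\<close>. Choosing \<open>g\<close> not to commute with \<open>x\<close> makes the
  commutator nontrivial.\<close>

lemma ex_almost_rank_one:
  assumes "x \<in> N" "\<not> scalar_imat x"
  shows "\<exists>y\<in>N. \<exists>u v j. y \<noteq> imat_one \<and> (\<forall>p q. q \<noteq> j \<longrightarrow> y (p, q) = imat_one (p, q) + u p * v q)"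
proof -
  obtain i j where ij: "i \<noteq> j" "imat_mult x (elem_mat i j 1) \<noteq> imat_mult (elem_mat i j 1) x"
    using commutes_with_elem_mats_imp_scalar assms(2) by blast
  let ?g = "elem_mat i j 1 :: ('i, 'f) imat"
  let ?x' = "inv\<^bsub>AU_group r\<^esub> x"
  let ?c = "imat_mult (imat_mult x ?g) ?x'"
  let ?y = "imat_mult ?c (inv\<^bsub>AU_group r\<^esub> ?g)"
  have x: "x \<in> AU_set r" and g: "?g \<in> AU_set r"
    using N_AU[OF assms(1)] elem_mat_AU[OF ij(1)] by blast+
  have inv_g: "inv\<^bsub>AU_group r\<^esub> ?g = elem_mat i j (-1)"
    by (rule G.inv_equality)
      (use ij(1) elem_mat_AU[OF ij(1)] in \<open>auto simp: elem_mat_mult_left elem_mat_apply imat_one_def\<close>)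
  have y: "?y (p, q) = imat_one (p, q) + x (p, i) * ?x' (j, q)" if "q \<noteq> j" for p q
    using that col_mat_conj[OF AU_almost_upper[OF x] AU_almost_upper[OF inv_AU(1)[OF x]] inv_AU(2)[OF x],
        of "{i}" "\<lambda>p. if p = i then 1 else 0" j]
    by (simp add: inv_g elem_mat_mult_right) (simp add: elem_mat_def)
  have "?y \<noteq> imat_one"
  proof
    assume "?y = imat_one"
    then have "?c = ?g"
      using G.inv_solve_right'[of imat_one ?c ?g] x g by (simp add: AU_mult inv_AU(1) imat_one_AU)
    then have "imat_mult x ?g = imat_mult ?g x"
      using G.inv_solve_right'[of ?g "imat_mult x ?g" x] x g by (simp add: AU_mult)
    with ij(2) show False by simp
  qed
  with y commutator_in_N[OF assms(1) g] show ?thesis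
    by (intro bexI[of _ ?y] exI[of _ "\<lambda>p. x (p, i)"] exI[of _ "\<lambda>q. ?x' (j, q)"] exI[of _ j]) auto
qed

text \<open>Take a column \<open>a\<close> with \<open>y a = a\<close> and commute \<open>y\<close>
  with \<open>g = 1 + a e_m\<close>. Then \<open>y g y^-1 = 1 + a (e_m y^-1)\<close>, and the factor
  \<open>g^-1 = 1 - a e_m\<close> preserves the form \<open>1 + a w\<close>.\<close>

lemma ex_rank_one:
  assumes "x \<in> N" "\<not> scalar_imat x"
  shows "\<exists>z\<in>N. \<exists>a w. finite {p. a p \<noteq> 0} \<and> z \<noteq> imat_one \<and>
    (\<forall>p q. z (p, q) = imat_one (p, q) + a p * w q)"
proof -
  obtain y u v j where y: "y \<in> N" "y \<noteq> imat_one"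
    and y_eq: "\<And>p q. q \<noteq> j \<Longrightarrow> y (p, q) = imat_one (p, q) + u p * v q"
    using ex_almost_rank_one[OF assms] by blast
  have y_AU: "y \<in> AU_set r"
    using N_AU y(1) by blast
  obtain m n where mn: "y (m, n) \<noteq> imat_one (m, n)"
    using y(2) by fastforce
  \<comment> \<open>Avoiding \<open>j\<close> makes the rank one formula for \<open>y\<close>
    available in the columns \<open>q1\<close> and \<open>q2\<close>; avoiding \<open>m\<close>
    gives \<open>a m = 0\<close>.\<close>
  obtain q1 where q1: "q1 \<notin> {j, m}"
    by (rule fresh_index[of "{j, m}"]) (simp, blast)
  obtain q2 where q2: "q2 \<notin> {j, m, q1}"
    by (rule fresh_index[of "{j, m, q1}"]) (simp, blast)
  \<comment> \<open>One linear condition on two unknowns has a nonzero solution; it makes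
    \<open>v\<close> annihilate the column \<open>a\<close>, whence \<open>y a = a\<close>.\<close>
  obtain \<alpha> \<beta> :: 'f where ab: "\<alpha> \<noteq> 0 \<or> \<beta> \<noteq> 0" "v q1 * \<alpha> + v q2 * \<beta> = 0"
  proof (cases "v q1 = 0")
    case True
    then show ?thesis using that[of 1 0] by simp
  next
    case False
    then show ?thesis using that[of "v q2" "- v q1"] by simp
  qed
  define a where "a = (\<lambda>p. if p = q1 then \<alpha> else if p = q2 then \<beta> else 0)"
  have a_supp: "a k = 0" if "k \<notin> {q1, q2}" for k
    using that by (simp add: a_def)
  then have "{p. a p \<noteq> 0} \<subseteq> {q1, q2}"
    by blast
  then have fin: "finite {p. a p \<noteq> 0}"
    using finite_subset by blast
  have q12: "q1 \<noteq> q2"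
    using q2 by auto
  have ya: "(\<Sum>k\<in>{q1, q2}. y (p, k) * a k) = a p" for p
  proof -
    have "(\<Sum>k\<in>{q1, q2}. y (p, k) * a k)
        = imat_one (p, q1) * \<alpha> + imat_one (p, q2) * \<beta> + u p * (v q1 * \<alpha> + v q2 * \<beta>)"
      using q1 q2 q12 by (simp add: a_def y_eq algebra_simps)
    also have "\<dots> = a p"
      using q2 unfolding ab(2) by (simp add: a_def imat_one_def)
    finally show ?thesis .
  qed
  have am: "a m = 0"
    using q1 q2 by (intro a_supp) auto
  let ?g = "col_mat a m"
  let ?y' = "inv\<^bsub>AU_group r\<^esub> y"
  let ?c = "imat_mult (imat_mult y ?g) ?y'"
  let ?z = "imat_mult ?c (inv\<^bsub>AU_group r\<^esub> ?g)"
  have g: "?g \<in> AU_set r"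
    using am fin by (intro col_mat_AU) auto
  have inv_g: "inv\<^bsub>AU_group r\<^esub> ?g = col_mat (\<lambda>p. - a p) m"
  proof (rule G.inv_equality)
    show "col_mat (\<lambda>p. - a p) m \<otimes>\<^bsub>AU_group r\<^esub> ?g = \<one>\<^bsub>AU_group r\<^esub>"
      using col_mat_inverse(2)[of a m] am by simp
    show "col_mat (\<lambda>p. - a p) m \<in> carrier (AU_group r)"
      using am fin by (simp add: col_mat_AU)
  qed (use g in simp)
  have c: "?c (p, q) = imat_one (p, q) + a p * ?y' (m, q)" for p q
    using col_mat_conj[OF AU_almost_upper[OF y_AU] AU_almost_upper[OF inv_AU(1)[OF y_AU]]
        inv_AU(2)[OF y_AU], of "{q1, q2}" a m p q] a_supp ya by simp
  \<comment> \<open>\<open>?c\<close> sends \<open>a\<close> to \<open>(1 + s) a\<close>, where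
    \<open>s\<close> is the entry of \<open>y^-1 a\<close> at \<open>m\<close>.\<close>
  define s where "s = (\<Sum>k\<in>{q1, q2}. ?y' (m, k) * a k)"
  have ca: "(\<Sum>k\<in>{q1, q2}. ?c (p, k) * - a k) = - a p * (1 + s)" for p
  proof -
    have "(\<Sum>k\<in>{q1, q2}. ?c (p, k) * - a k)
        = - (\<Sum>k\<in>{q1, q2}. imat_one (p, k) * a k) - a p * s"
      using q12 by (simp add: c s_def algebra_simps)
    also have "(\<Sum>k\<in>{q1, q2}. imat_one (p, k) * a k) = a p"
      using q12 by (simp add: a_def imat_one_def)
    finally show ?thesis
      by (simp add: algebra_simps)
  qed
  have z: "?z (p, q) = imat_one (p, q) + a p * (?y' (m, q) - (if q = m then 1 + s else 0))" for p q
  proof -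
    have "?z (p, q) = ?c (p, q) + (if q = m then \<Sum>k\<in>{q1, q2}. ?c (p, k) * - a k else 0)"
      unfolding inv_g by (rule col_mat_mult_right) (use a_supp in auto)
    then show ?thesis
      unfolding ca by (simp add: c algebra_simps)
  qed
  have "?z \<noteq> imat_one"
  proof
    assume "?z = imat_one"
    then have "?c = ?g"
      using G.inv_solve_right'[of imat_one ?c ?g] y_AU g by (simp add: AU_mult inv_AU(1) imat_one_AU)
    then have comm: "imat_mult y ?g = imat_mult ?g y"
      using G.inv_solve_right'[of ?g "imat_mult y ?g" y] y_AU g by (simp add: AU_mult)
    \<comment> \<open>Cancelling a nonzero \<open>a p\<close> in the entry \<open>(p, n)\<close> of
      the relation forces \<open>y (m, n) = imat_one (m, n)\<close>, against the choice of
      \<open>m\<close> and \<open>n\<close>.\<close>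
    obtain p where p: "a p \<noteq> 0"
      using ab(1) q12 that[of q1] that[of q2] by (auto simp: a_def)
    have "imat_mult y ?g (p, n) = y (p, n) + (if n = m then a p else 0)"
      unfolding ya[of p, symmetric] by (rule col_mat_mult_right) (use a_supp in auto)
    then have "y (p, n) + (if n = m then a p else 0) = y (p, n) + a p * y (m, n)"
      using fun_cong[OF comm, of "(p, n)"] by (simp add: col_mat_mult_left)
    with p mn show False
      by (auto simp: imat_one_def split: if_splits)
  qed
  with z fin commutator_in_N[OF y(1) g] show ?thesis
    by (intro bexI[of _ ?z] exI[of _ a] exI[of _ "\<lambda>q. ?y' (m, q) - (if q = m then 1 + s else 0)"]) auto
qed

text \<open>The commutator of \<open>1 + a w\<close> with the elementary matrix at
  \<open>(k, l)\<close>, where \<open>w k\<close> is nonzero and \<open>a l = 0\<close>, is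
  \<open>1 + w k * a e_l\<close>. Such an \<open>l\<close> exists because \<open>a\<close> has
  finite support and the index set is infinite.\<close>

lemma ex_col_mat:
  assumes "x \<in> N" "\<not> scalar_imat x"
  shows "\<exists>b l s. finite {p. b p \<noteq> 0} \<and> b l = 0 \<and> b s \<noteq> 0 \<and> col_mat b l \<in> N"
proof -
  obtain z a w where z: "z \<in> N" "z \<noteq> imat_one" and fin: "finite {p. a p \<noteq> 0}"
    and z_eq: "\<And>p q. z (p, q) = imat_one (p, q) + a p * w q"
    using ex_rank_one[OF assms] by blast
  obtain s k where "z (s, k) \<noteq> imat_one (s, k)"
    using z(2) by fastforce
  then have sk: "a s \<noteq> 0" "w k \<noteq> 0"
    by (auto simp: z_eq)
  have "finite (insert k {p. a p \<noteq> 0})"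
    using fin by simp
  then obtain l where l: "l \<noteq> k" "a l = 0"
    using fresh_index by (metis (mono_tags, lifting) insertCI mem_Collect_eq)
  let ?b = "\<lambda>p. w k * a p"
  let ?g = "elem_mat k l 1 :: ('i, 'f) imat"
  have finb: "finite {p. ?b p \<noteq> 0}"
    using fin by (rule rev_finite_subset) auto
  have "col_mat ?b l \<in> N"
  proof (rule commutator_relation[OF z(1)])
    show "?g \<in> AU_set r"
      using l by (intro elem_mat_AU) auto
    show "col_mat ?b l \<in> AU_set r"
      using finb l by (intro col_mat_AU) auto
    show "imat_mult z ?g = imat_mult (col_mat ?b l) (imat_mult ?g z)"
      using l by (auto simp: fun_eq_iff elem_mat_mult_left elem_mat_mult_right col_mat_mult_left
          z_eq imat_one_def algebra_simps)
  qed
  with finb l sk show ?thesis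
    by (intro exI[of _ ?b] exI[of _ l] exI[of _ s]) auto
qed

text \<open>The commutator with the elementary matrix at \<open>(p, s)\<close>, for a fresh row
  \<open>p\<close>, copies the entry \<open>b s\<close> into row \<open>p\<close> and drops the rest
  of the column.\<close>

lemma ex_elem_mat:
  assumes "x \<in> N" "\<not> scalar_imat x"
  shows "\<exists>p l c. p \<noteq> l \<and> c \<noteq> 0 \<and> elem_mat p l c \<in> N"
proof -
  obtain b l s where b: "b l = 0" "b s \<noteq> 0" "col_mat b l \<in> N"
    using ex_col_mat[OF assms] by blast
  obtain p where p: "p \<notin> {l, s}"
    by (rule fresh_index[of "{l, s}"]) (simp, blast)
  have "l \<noteq> s" using b by auto
  let ?g = "elem_mat p s 1 :: ('i, 'f) imat"
  have "elem_mat p l (b s) \<in> N"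
  proof (rule commutator_relation'[OF b(3)])
    show "?g \<in> AU_set r" "elem_mat p l (b s) \<in> AU_set r"
      using p by (auto intro: elem_mat_AU)
    show "imat_mult ?g (col_mat b l) = imat_mult (elem_mat p l (b s)) (imat_mult (col_mat b l) ?g)"
      using p b(1) \<open>l \<noteq> s\<close>
      by (auto simp: fun_eq_iff elem_mat_mult_left elem_mat_mult_right col_mat_def imat_one_def)
  qed
  with p b(2) show ?thesis
    by blast
qed

text \<open>The Steinberg relation \<open>[e_sp(c/\<mu>), e_pl(\<mu>)] = e_sl(c)\<close>; division
  by \<mu> makes the new coefficient arbitrary.\<close>

lemma elem_mat_change_row:
  assumes "elem_mat p l \<mu> \<in> N" "\<mu> \<noteq> 0" "s \<noteq> p" "s \<noteq> l" "p \<noteq> l"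
  shows "elem_mat s l c \<in> N"
proof (rule commutator_relation'[OF assms(1)])
  show "elem_mat s p (c / \<mu>) \<in> AU_set r" "elem_mat s l c \<in> AU_set r"
    using assms by (auto intro: elem_mat_AU)
  show "imat_mult (elem_mat s p (c / \<mu>)) (elem_mat p l \<mu>)
      = imat_mult (elem_mat s l c) (imat_mult (elem_mat p l \<mu>) (elem_mat s p (c / \<mu>)))"
    using assms by (auto simp: fun_eq_iff elem_mat_mult_left elem_mat_apply)
qed

text \<open>The Steinberg relation \<open>[e_sl(c), e_lt(1)] = e_st(c)\<close>.\<close>

lemma elem_mat_change_col:
  assumes "elem_mat s l c \<in> N" "t \<noteq> s" "t \<noteq> l" "s \<noteq> l"
  shows "elem_mat s t c \<in> N"
proof (rule commutator_relation[OF assms(1)])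
  show "(elem_mat l t 1 :: ('i, 'f) imat) \<in> AU_set r"
    using assms(3) by (intro elem_mat_AU) simp
  show "elem_mat s t c \<in> AU_set r"
    using assms(2) by (intro elem_mat_AU) simp
  show "imat_mult (elem_mat s l c) (elem_mat l t 1)
      = imat_mult (elem_mat s t c) (imat_mult (elem_mat l t 1) (elem_mat s l c))"
    using assms by (auto simp: fun_eq_iff elem_mat_mult_left elem_mat_apply)
qed

text \<open>First column \<open>l\<close> is reached with every row and coefficient, then column
  \<open>t\<close> in an auxiliary row \<open>q\<close>, and finally row \<open>s\<close>. The
  relations require distinct indices, so fresh rows are interposed.\<close>

lemma elem_mat_in_N:
  assumes "x \<in> N" "\<not> scalar_imat x" "s \<noteq> t"
  shows "elem_mat s t c \<in> N"
proof -
  obtain p l \<mu> where pl: "p \<noteq> l" "\<mu> \<noteq> 0" "elem_mat p l \<mu> \<in> N"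
    using ex_elem_mat[OF assms(1,2)] by blast
  have col_l: "elem_mat s l c \<in> N" if "s \<noteq> l" for s c
  proof (cases "s = p")
    case False
    then show ?thesis
      using elem_mat_change_row[OF pl(3,2)] that pl(1) by blast
  next
    case True
    obtain q where q: "q \<notin> {p, l}"
      by (rule fresh_index[of "{p, l}"]) (simp, blast)
    then have "elem_mat q l 1 \<in> N"
      using elem_mat_change_row[OF pl(3,2)] pl(1) by blast
    then show ?thesis
      using elem_mat_change_row[of q l 1 s] q that True by auto
  qed
  obtain q where q: "q \<notin> {s, t, l}"
    by (rule fresh_index[of "{s, t, l}"]) (simp, blast)
  have col_t: "elem_mat q t 1 \<in> N"
    using q col_l[of q 1] elem_mat_change_col[of q l 1 t] by (cases "t = l") auto
  show ?thesis
    by (rule elem_mat_change_row[OF col_t]) (use q assms(3) in auto)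
qed

end

text \<open>By \<open>elem_mat_in_N\<close> the assumption \<open>elem_mats\<close> holds as soon as
  \<open>N\<close> has a nonscalar element. Closedness enters only from here on.\<close>

locale AU_closed_normal_subgroup = AU_normal_subgroup r N
  for r :: "'i \<Rightarrow> 'i \<Rightarrow> bool" and N :: "('i, 'f::{field, finite}) imat set" +
  assumes closed: "closedin (AU_nbhd_topology r) N"
    and elem_mats: "\<And>s t c. s \<noteq> t \<Longrightarrow> elem_mat s t c \<in> N"
begin

lemma N_closedI:
  assumes "x \<in> AU_set r" "\<And>S. finite S \<Longrightarrow> \<exists>y\<in>N. agree_off r S x y"
  shows "x \<in> N"
proof (rule ccontr)
  assume "x \<notin> N"
  moreover have "openin (AU_nbhd_topology r) (AU_set r - N)"
    using closed by (simp add: closedin_def)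
  ultimately obtain S where "finite S" "\<forall>y\<in>AU_set r. agree_off r S x y \<longrightarrow> y \<in> AU_set r - N"
    using assms(1) by (auto simp: openin_AU_nbhd_topology)
  then show False
    using assms(2) N_AU by blast
qed

text \<open>
  By Whitehead's lemma \<open>N\<close> contains \<open>diag(c, c\<^sup>-\<^sup>1)\<close> at the positions \<open>m\<close> and \<open>t\<close>, which
  tends to \<open>diag(c)\<close> at \<open>m\<close> as \<open>t\<close> leaves every finite set.
\<close>

lemma diagonal_in_N:
  assumes "c \<noteq> 0"
  shows "col_mat (\<lambda>p. if p = m then c - 1 else 0) m \<in> N"
proof (rule N_closedI)
  show "col_mat (\<lambda>p. if p = m then c - 1 else 0) m \<in> AU_set r"
    using assms by (intro col_mat_AU) auto
  fix S :: "('i \<times> 'i) set" assume "finite S"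
  then have "finite (insert m (fst ` S))"
    by simp
  then obtain t where t: "t \<notin> insert m (fst ` S)"
    by (rule fresh_index)
  \<comment> \<open>The first three factors form the monomial matrix \<open>w(c)\<close>, the last
    three \<open>w(-1)\<close>, and their product is \<open>diag(c, 1/c)\<close> at \<open>m\<close>
    and \<open>t\<close>. It misses the limit only at \<open>(t, t)\<close>, which is outside
    \<open>S\<close> and, as \<open>r t t\<close> holds, not constrained.\<close>
  define y where "y = imat_mult (elem_mat m t c) (imat_mult (elem_mat t m (- 1 / c))
    (imat_mult (elem_mat m t c) (imat_mult (elem_mat m t (- 1))
    (imat_mult (elem_mat t m 1) (elem_mat m t (- 1))))))"
  have "y \<in> N"
    unfolding y_def using t by (intro N_mult elem_mats) auto
  moreover have "y (p, q) = col_mat (\<lambda>p. if p = m then c - 1 else 0) m (p, q)"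
    if "(p, q) \<noteq> (t, t)" for p q
    using that t assms
    by (auto simp: y_def elem_mat_mult_left elem_mat_apply col_mat_def imat_one_def divide_simps
        algebra_simps)
  then have "agree_off r S (col_mat (\<lambda>p. if p = m then c - 1 else 0) m) y"
    unfolding agree_off_def using t by (metis fst_conv image_eqI insertCI prod.inject r_refl)
  ultimately show "\<exists>y\<in>N. agree_off r S (col_mat (\<lambda>p. if p = m then c - 1 else 0) m) y"
    by blast
qed

lemma unipotent_col_mat_in_N:
  assumes "finite A" "m \<notin> A" "\<And>p. p \<notin> A \<Longrightarrow> a p = 0"
  shows "col_mat a m \<in> N"
  using assms
proof (induction A arbitrary: a rule: finite_induct)
  case empty
  then show ?case
    using N_one by (simp add: col_mat_0)
next
  case (insert k A)
  have "col_mat (a(k := 0)) m \<in> N"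
    using insert by auto
  moreover have "elem_mat k m (a k) \<in> N"
    using insert by (intro elem_mats) auto
  moreover have "imat_mult (elem_mat k m (a k)) (col_mat (a(k := 0)) m) = col_mat a m"
    unfolding elem_mat_def col_mat_mult_col_mat
    using insert by (intro arg_cong2[of _ _ _ _ col_mat]) (auto simp: fun_eq_iff)
  ultimately show ?case
    using N_mult by metis
qed

text \<open>Factors the matrix into a diagonal and a unipotent one. In this order the cross term
  vanishes, because the second column is 0 at \<open>m\<close>.\<close>

lemma col_mat_in_N:
  assumes "finite {p. a p \<noteq> 0}" "1 + a m \<noteq> 0"
  shows "col_mat a m \<in> N"
proof -
  have "col_mat (a(m := 0)) m \<in> N"
    by (rule unipotent_col_mat_in_N[of "{p. a p \<noteq> 0} - {m}"]) (use assms in auto)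
  moreover have "col_mat (\<lambda>p. if p = m then (1 + a m) - 1 else 0) m \<in> N"
    by (rule diagonal_in_N[OF assms(2)])
  moreover have "imat_mult (col_mat (\<lambda>p. if p = m then (1 + a m) - 1 else 0) m) (col_mat (a(m := 0)) m)
      = col_mat a m"
    unfolding col_mat_mult_col_mat by (intro arg_cong2[of _ _ _ _ col_mat]) (auto simp: fun_eq_iff)
  ultimately show ?thesis
    using N_mult by metis
qed

text \<open>Gaussian elimination by row operations from \<open>N\<close>; the induction is on the
  set \<open>K\<close> of columns that may still differ from those of the identity.\<close>

lemma finitary_in_N:
  assumes "finite K" "x \<in> AU_set r" "\<And>q. finite {p. x (p, q) \<noteq> 0}"
    and "\<And>p q. q \<notin> K \<Longrightarrow> x (p, q) = imat_one (p, q)"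
  shows "x \<in> N"
  using assms
proof (induction K arbitrary: x rule: finite_induct)
  case empty
  then have "x = imat_one"
    by auto
  then show ?case
    using N_one by simp
next
  case (insert k K)
  have pivot: "x \<in> N"
    if x: "x \<in> AU_set r" "\<And>q. finite {p. x (p, q) \<noteq> 0}"
      "\<And>p q. q \<notin> insert k K \<Longrightarrow> x (p, q) = imat_one (p, q)" "x (k, k) \<noteq> 0" for x
  proof -
    \<comment> \<open>\<open>u\<close> solves
      \<open>x (p, k) + u p * x (k, k) = imat_one (p, k)\<close>, so that
      \<open>1 + u k = 1 / x (k, k)\<close>.\<close>
    define u where "u p = - (x (p, k) - imat_one (p, k)) / x (k, k)" for p
    have "finite (insert k {p. x (p, k) \<noteq> 0})"
      using x(2) by simp
    then have finu: "finite {p. u p \<noteq> 0}"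
      by (rule rev_finite_subset) (auto simp: u_def imat_one_def)
    have uk: "1 + u k \<noteq> 0"
      using x(4) by (simp add: u_def imat_one_def divide_simps)
    let ?g = "col_mat u k"
    have g: "?g \<in> N"
      by (rule col_mat_in_N[OF finu uk])
    have "imat_mult ?g x \<in> N"
    proof (rule insert.IH)
      show "imat_mult ?g x \<in> AU_set r"
        using g N_AU x(1) AU_mult by blast
      show "finite {p. imat_mult ?g x (p, q) \<noteq> 0}" for q
        by (rule finite_subset[of _ "{p. x (p, q) \<noteq> 0} \<union> {p. u p \<noteq> 0}"])
          (use x(2) finu in \<open>auto simp: col_mat_mult_left\<close>)
      show "imat_mult ?g x (p, q) = imat_one (p, q)" if "q \<notin> K" for p q
      proof (cases "q = k")
        case True
        then show ?thesis
          using x(4) by (simp add: col_mat_mult_left u_def)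
      next
        \<comment> \<open>A column already equal to that of the identity is 0 in row
          \<open>k\<close>, so the row operation preserves it.\<close>
        case False
        then show ?thesis
          using x(3)[of q] that by (simp add: col_mat_mult_left imat_one_def)
      qed
    qed
    then show ?thesis
      using N_cancel_left[OF x(1) g] by blast
  qed
  show ?case
  proof (cases "x (k, k) = 0")
    case False
    with pivot insert.prems show ?thesis
      by blast
  next
    case True
    \<comment> \<open>Otherwise the entry \<open>(k, k)\<close> of \<open>x^-1 x\<close> would
      vanish termwise: for \<open>l\<close> in \<open>insert k K\<close> the factor
      \<open>x (l, k)\<close> is 0, and for any other \<open>l\<close> column \<open>l\<close> of
      \<open>x\<close> is that of the identity, which forces \<open>x^-1\<close> to be 0 at
      \<open>(k, l)\<close>.\<close>
    have "\<exists>p\<in>insert k K. x (p, k) \<noteq> 0"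
    proof (rule ccontr)
      let ?x' = "inv\<^bsub>AU_group r\<^esub> x"
      assume *: "\<not> (\<exists>p\<in>insert k K. x (p, k) \<noteq> 0)"
      have zero: "?x' (k, l) * x (l, k) = 0" for l
      proof (cases "l \<in> insert k K")
        case False
        then have "imat_mult ?x' x (k, l) = ?x' (k, l)"
          using insert.prems(3)[of l] by (subst imat_mult_eq_sum[of "{l}"]) (auto simp: imat_one_def)
        then show ?thesis
          using inv_AU(3)[OF insert.prems(1)] False by (auto simp: imat_one_def)
      qed (use * in auto)
      have "imat_mult ?x' x (k, k) = 0"
        by (simp only: imat_mult_def case_prod_conv zero Sum_any.neutral)
      then show False
        using inv_AU(3)[OF insert.prems(1)] by (simp add: imat_one_def)
    qed
    then obtain p where p: "p \<in> K" "p \<noteq> k" "x (p, k) \<noteq> 0"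
      using True by auto
    let ?g = "elem_mat k p 1 :: ('i, 'f) imat"
    have g: "?g \<in> N"
      using p by (intro elem_mats) auto
    have "imat_mult ?g x \<in> N"
    proof (rule pivot)
      show "imat_mult ?g x \<in> AU_set r"
        using g N_AU insert.prems(1) AU_mult by blast
      show "finite {p. imat_mult ?g x (p, q) \<noteq> 0}" for q
        by (rule finite_subset[of _ "insert k {p. x (p, q) \<noteq> 0}"])
          (use insert.prems(2) in \<open>auto simp: elem_mat_mult_left\<close>)
      show "imat_mult ?g x (s, q) = imat_one (s, q)" if "q \<notin> insert k K" for s q
        using insert.prems(3)[OF that] that p by (auto simp: elem_mat_mult_left imat_one_def)
      show "imat_mult ?g x (k, k) \<noteq> 0"
        using True p by (simp add: elem_mat_mult_left)
    qed
    then show ?thesis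
      using N_cancel_left[OF insert.prems(1) g] by blast
  qed
qed

lemma N_eq_AU: "N = AU_set r"
proof
  show "N \<subseteq> AU_set r"
    using N_AU by blast
  show "AU_set r \<subseteq> N"
  proof
    fix x :: "('i, 'f) imat" assume x: "x \<in> AU_set r"
    show "x \<in> N"
    proof (rule N_closedI[OF x])
      fix S :: "('i \<times> 'i) set" assume "finite S"
      then obtain M where M: "finite M" "strongly_convex r M" "S \<subseteq> M \<times> M"
        and up: "upper_triangular (preord_merge r M) x"
        using sconvex_hull_support[of "{x}" S] x AU_almost_upper by auto
      interpret fh: finite_hull_preorder "preord_merge r M"
        using M finite_hull_preorder_merge by blast
      have conv: "preord_convex (preord_merge r M) M"
        using convex_merge sconvex_imp_convex[OF M(2)] by blast
      \<comment> \<open>\<open>pad x\<close> keeps the block on \<open>M\<close> and is the identity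
        elsewhere. As \<open>M x M\<close> contains \<open>S\<close> and all nonzero entries of
        \<open>x\<close> that violate \<open>r\<close>, it approximates \<open>x\<close>.\<close>
      define pad where "pad = (\<lambda>(a :: ('i, 'f) imat) (i, j).
        if i \<in> M \<and> j \<in> M then a (i, j) else imat_one (i, j))"
      have up_pad: "upper_triangular (preord_merge r M) (pad a)" for a
        by (auto simp: upper_triangular_def pad_def imat_one_def merge_iff)
      have pad_mult: "imat_mult (pad a) (pad b) = imat_one" if "inverse_on M a b" for a b
      proof (rule ext, clarify)
        fix i j
        consider "i \<in> M" "j \<in> M" | "i \<notin> M" | "i \<in> M" "j \<notin> M" by blast
        then show "imat_mult (pad a) (pad b) (i, j) = imat_one (i, j)"
        proof cases
          case 1
          have "imat_mult (pad a) (pad b) (i, j) = (\<Sum>k\<in>M. pad a (i, k) * pad b (k, j))"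
            using 1 by (intro upper_triangular_mult_eq_sum[OF up_pad up_pad M(1) conv])
          also have "\<dots> = (\<Sum>k\<in>M. a (i, k) * b (k, j))"
            using 1 by (simp add: pad_def)
          finally show ?thesis
            using that 1 by (simp add: inverse_on_def imat_one_def)
        next
          case 2
          then show ?thesis
            by (subst imat_mult_eq_sum[of "{i}"]) (auto simp: pad_def imat_one_def)
        next
          case 3
          then show ?thesis
            by (subst imat_mult_eq_sum[of "{j}"]) (auto simp: pad_def imat_one_def)
        qed
      qed
      let ?x' = "inv\<^bsub>AU_group r\<^esub> x"
      \<comment> \<open>The block of \<open>x^-1\<close> inverts the block of \<open>x\<close>, so
        padding it inverts \<open>pad x\<close>.\<close>
      have "inverse_on M x ?x'"
        using upper_triangular_inv_AU[OF x M(1) up]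
        by (intro fh.inverse_on_of_inverse[OF up _ inv_AU(2,3)[OF x] M(1) conv])
      then have "imat_mult (pad x) (pad ?x') = imat_one" "imat_mult (pad ?x') (pad x) = imat_one"
        by (auto intro!: pad_mult simp: inverse_on_def)
      then have "pad x \<in> AU_set r"
        using up_pad M(1) almost_upper_triangular_iff by (intro AU_I[of _ "pad ?x'"]) blast+
      then have "pad x \<in> N"
      proof (rule finitary_in_N[OF M(1)])
        show "finite {p. pad x (p, q) \<noteq> 0}" for q
          by (rule finite_subset[of _ "insert q M"])
            (use M(1) in \<open>auto simp: pad_def imat_one_def split: if_splits\<close>)
      qed (simp add: pad_def)
      moreover have "agree_off r S x (pad x)"
        by (rule agree_offI[OF M(2,3) up up_pad]) (simp add: pad_def)
      ultimately show "\<exists>y\<in>N. agree_off r S x y"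
        by blast
    qed
  qed
qed

end

section \<open>Quotients of topological groups\<close>

lemma topspace_coset_topology:
  assumes "topspace T = carrier G"
  shows "topspace (coset_topology G T N) = carrier (G Mod N)"
proof -
  have "topspace (coset_topology G T N) = (\<lambda>x. N #>\<^bsub>G\<^esub> x) ` carrier G"
    using quotient_imp_surjective_map[OF quotient_map_coset_topology[OF assms]] assms by metis
  then show ?thesis
    by (auto simp: FactGroup_def RCOSETS_def)
qed

lemma continuous_map_left_translation:
  assumes "group_topology G T" "g \<in> carrier G"
  shows "continuous_map T T (\<lambda>x. g \<otimes>\<^bsub>G\<^esub> x)"
proof -
  have "continuous_map T (prod_topology T T) (\<lambda>x. (g, x))"
    using assms by (intro continuous_map_pairedI) (auto simp: group_topology_def)
  moreover have "continuous_map (prod_topology T T) T (\<lambda>(x, y). x \<otimes>\<^bsub>G\<^esub> y)"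
    using assms(1) by (simp add: group_topology_def)
  ultimately show ?thesis
    using continuous_map_compose by (fastforce simp: o_def)
qed

text \<open>The saturation of \<open>V\<close> is the union, over \<open>n\<close> in
  \<open>N\<close>, of the preimages of \<open>V\<close> under left translation by \<open>n\<close>,
  and each of these is open.\<close>

lemma open_map_coset_topology:
  assumes gt: "group_topology G T" and N: "N \<lhd> G"
  shows "open_map T (coset_topology G T N) (\<lambda>x. N #>\<^bsub>G\<^esub> x)"
  unfolding open_map_def
proof (intro allI impI)
  interpret normal N G by fact
  fix V assume V: "openin T V"
  have top: "topspace T = carrier G"
    using gt by (simp add: group_topology_def)
  have VG: "V \<subseteq> carrier G"
    using openin_subset[OF V] top by simp
  have iff: "N #>\<^bsub>G\<^esub> x \<in> (\<lambda>x. N #>\<^bsub>G\<^esub> x) ` V \<longleftrightarrow> (\<exists>n\<in>N. n \<otimes>\<^bsub>G\<^esub> x \<in> V)" if x: "x \<in> carrier G" for x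
  proof
    assume "N #>\<^bsub>G\<^esub> x \<in> (\<lambda>x. N #>\<^bsub>G\<^esub> x) ` V"
    then obtain v where v: "v \<in> V" "N #>\<^bsub>G\<^esub> x = N #>\<^bsub>G\<^esub> v"
      by blast
    then have "v \<in> N #>\<^bsub>G\<^esub> x"
      using rcos_self[of v N] VG is_subgroup by auto
    with v(1) show "\<exists>n\<in>N. n \<otimes>\<^bsub>G\<^esub> x \<in> V"
      by (auto simp: r_coset_def)
  next
    assume "\<exists>n\<in>N. n \<otimes>\<^bsub>G\<^esub> x \<in> V"
    then obtain n where n: "n \<in> N" "n \<otimes>\<^bsub>G\<^esub> x \<in> V"
      by blast
    then have "N #>\<^bsub>G\<^esub> x = N #>\<^bsub>G\<^esub> (n \<otimes>\<^bsub>G\<^esub> x)"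
      using x is_subgroup by (intro repr_independence) (auto simp: r_coset_def)
    with n(2) show "N #>\<^bsub>G\<^esub> x \<in> (\<lambda>x. N #>\<^bsub>G\<^esub> x) ` V"
      by blast
  qed
  have "{x \<in> topspace T. N #>\<^bsub>G\<^esub> x \<in> (\<lambda>x. N #>\<^bsub>G\<^esub> x) ` V}
      = {x \<in> topspace T. \<exists>n\<in>N. n \<otimes>\<^bsub>G\<^esub> x \<in> V}"
    by (simp add: top iff cong: conj_cong)
  also have "\<dots> = (\<Union>n\<in>N. {x \<in> topspace T. n \<otimes>\<^bsub>G\<^esub> x \<in> V})"
    by blast
  finally have "{x \<in> topspace T. N #>\<^bsub>G\<^esub> x \<in> (\<lambda>x. N #>\<^bsub>G\<^esub> x) ` V}
      = (\<Union>n\<in>N. {x \<in> topspace T. n \<otimes>\<^bsub>G\<^esub> x \<in> V})" .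
  moreover have "openin T {x \<in> topspace T. n \<otimes>\<^bsub>G\<^esub> x \<in> V}" if "n \<in> N" for n
    using openin_continuous_map_preimage[OF continuous_map_left_translation[OF gt] V] that by simp
  ultimately have "openin T {x \<in> topspace T. N #>\<^bsub>G\<^esub> x \<in> (\<lambda>x. N #>\<^bsub>G\<^esub> x) ` V}"
    by auto
  moreover have "(\<lambda>x. N #>\<^bsub>G\<^esub> x) ` V \<subseteq> carrier (G Mod N)"
    using VG by (auto simp: FactGroup_def RCOSETS_def)
  ultimately show "openin (coset_topology G T N) ((\<lambda>x. N #>\<^bsub>G\<^esub> x) ` V)"
    by (simp add: openin_coset_topology)
qed

text \<open>A product of two quotient maps need not be a quotient map. Continuity of multiplication
  therefore rests on openness of the projection, which carries an open box around
  \<open>(x, y)\<close> to an open box; for inversion the quotient property suffices.\<close>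

lemma group_topology_coset_topology:
  assumes gt: "group_topology G T" and N: "N \<lhd> G"
  shows "group_topology (G Mod N) (coset_topology G T N)"
proof -
  interpret normal N G by fact
  let ?Q = "coset_topology G T N"
  let ?\<pi> = "\<lambda>x. N #>\<^bsub>G\<^esub> x"
  have top: "topspace T = carrier G"
    and mult: "continuous_map (prod_topology T T) T (\<lambda>(x, y). x \<otimes>\<^bsub>G\<^esub> y)"
    and inv: "continuous_map T T (\<lambda>x. inv\<^bsub>G\<^esub> x)"
    using gt by (simp_all add: group_topology_def)
  have topQ: "topspace ?Q = carrier (G Mod N)"
    by (rule topspace_coset_topology[OF top])
  have quot: "quotient_map T ?Q ?\<pi>"
    by (rule quotient_map_coset_topology[OF top])
  have carr: "carrier (G Mod N) = ?\<pi> ` carrier G"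
    by (auto simp: FactGroup_def RCOSETS_def)
  have grp: "group (G Mod N)"
    by (rule factorgroup_is_group)
  interpret Q: group "G Mod N" by (rule grp)
  interpret h: group_hom G "G Mod N" ?\<pi>
    by unfold_locales (rule r_coset_hom_Mod)
  have "continuous_map (prod_topology ?Q ?Q) ?Q (\<lambda>(A, B). A \<otimes>\<^bsub>G Mod N\<^esub> B)"
    unfolding continuous_map_def
  proof (intro conjI allI impI)
    show "(\<lambda>(A, B). A \<otimes>\<^bsub>G Mod N\<^esub> B) \<in> topspace (prod_topology ?Q ?Q) \<rightarrow> topspace ?Q"
      using Q.m_closed by (auto simp: topQ simp del: mult_FactGroup)
    fix W assume W: "openin ?Q W"
    let ?W = "{p \<in> topspace (prod_topology ?Q ?Q). (case p of (A, B) \<Rightarrow> A \<otimes>\<^bsub>G Mod N\<^esub> B) \<in> W}"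
    show "openin (prod_topology ?Q ?Q) ?W"
      unfolding openin_prod_topology_alt
    proof (intro allI impI)
      fix A B assume "(A, B) \<in> ?W"
      then obtain x y where xy: "x \<in> carrier G" "y \<in> carrier G" "A = ?\<pi> x" "B = ?\<pi> y"
        and "?\<pi> x \<otimes>\<^bsub>G Mod N\<^esub> ?\<pi> y \<in> W"
        by (auto simp: topQ carr)
      then have "?\<pi> (x \<otimes>\<^bsub>G\<^esub> y) \<in> W"
        by simp
      let ?P = "{p \<in> topspace (prod_topology T T).
          (case p of (x, y) \<Rightarrow> x \<otimes>\<^bsub>G\<^esub> y) \<in> {z \<in> topspace T. ?\<pi> z \<in> W}}"
      have "openin T {z \<in> topspace T. ?\<pi> z \<in> W}"
        by (rule openin_continuous_map_preimage[OF quotient_imp_continuous_map[OF quot] W])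
      then have "openin (prod_topology T T) ?P"
        by (rule openin_continuous_map_preimage[OF mult])
      moreover have "(x, y) \<in> ?P"
        using xy(1,2) \<open>?\<pi> (x \<otimes>\<^bsub>G\<^esub> y) \<in> W\<close> by (simp add: top)
      ultimately obtain U V where UV: "openin T U" "openin T V" "x \<in> U" "y \<in> V" "U \<times> V \<subseteq> ?P"
        unfolding openin_prod_topology_alt by meson
      have "?\<pi> u \<otimes>\<^bsub>G Mod N\<^esub> ?\<pi> v \<in> W" "u \<in> carrier G" "v \<in> carrier G" if "u \<in> U" "v \<in> V" for u v
      proof -
        show uv: "u \<in> carrier G" "v \<in> carrier G"
          using that openin_subset[OF UV(1)] openin_subset[OF UV(2)] top by auto
        have "?\<pi> (u \<otimes>\<^bsub>G\<^esub> v) \<in> W"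
          using subsetD[OF UV(5), of "(u, v)"] that by simp
        then show "?\<pi> u \<otimes>\<^bsub>G Mod N\<^esub> ?\<pi> v \<in> W"
          using uv by simp
      qed
      then have "?\<pi> ` U \<times> ?\<pi> ` V \<subseteq> ?W"
        using UV(3,4) by (auto simp: topQ carr)
      moreover have "openin ?Q (?\<pi> ` U)" "openin ?Q (?\<pi> ` V)"
        using open_map_coset_topology[OF gt N] UV(1,2) by (auto simp: open_map_def)
      ultimately show "\<exists>U V. openin ?Q U \<and> openin ?Q V \<and> A \<in> U \<and> B \<in> V \<and> U \<times> V \<subseteq> ?W"
        using UV(3,4) xy(3,4) by blast
    qed
  qed
  moreover have "continuous_map ?Q ?Q (\<lambda>A. inv\<^bsub>G Mod N\<^esub> A)"
  proof (rule continuous_compose_quotient_map[OF quot])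
    have "continuous_map T ?Q (?\<pi> \<circ> (\<lambda>x. inv\<^bsub>G\<^esub> x))"
      using inv quotient_imp_continuous_map[OF quot] by (rule continuous_map_compose)
    then show "continuous_map T ?Q ((\<lambda>A. inv\<^bsub>G Mod N\<^esub> A) \<circ> ?\<pi>)"
      by (rule continuous_map_eq) (simp add: top)
  qed
  ultimately show ?thesis
    using grp topQ by (simp add: group_topology_def)
qed

text \<open>The preimage in \<open>G\<close> of a closed normal subgroup is closed and normal, so by
  maximality it is all of \<open>G\<close> or lies in \<open>Z\<close>. Accordingly the subgroup is
  the whole quotient or trivial.\<close>

lemma topologically_simple_quotient:
  assumes gt: "group_topology G T" and Z: "proper_closed_normal G T Z"
    and max: "\<And>N. proper_closed_normal G T N \<Longrightarrow> N \<subseteq> Z"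
  shows "topologically_simple (G Mod Z) (coset_topology G T Z)"
proof -
  have nZ: "Z \<lhd> G" and ne: "Z \<noteq> carrier G"
    using Z by (simp_all add: proper_closed_normal_def)
  interpret normal Z G by fact
  let ?Q = "coset_topology G T Z"
  let ?\<pi> = "\<lambda>x. Z #>\<^bsub>G\<^esub> x"
  have top: "topspace T = carrier G"
    using gt by (simp add: group_topology_def)
  have carr: "carrier (G Mod Z) = ?\<pi> ` carrier G"
    by (auto simp: FactGroup_def RCOSETS_def)
  interpret Q: group "G Mod Z" by (rule factorgroup_is_group)
  interpret h: group_hom G "G Mod Z" ?\<pi>
    by unfold_locales (rule r_coset_hom_Mod)
  have one: "\<one>\<^bsub>G Mod Z\<^esub> = Z"
    by (simp add: FactGroup_def)
  have in_Z: "?\<pi> x = Z \<longleftrightarrow> x \<in> Z" if "x \<in> carrier G" for x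
    using coset_join1[OF _ that is_subgroup] coset_join2[OF that is_subgroup] by blast
  have "carrier (G Mod Z) \<noteq> {Z}"
  proof
    assume "carrier (G Mod Z) = {Z}"
    then have "?\<pi> x = Z" if "x \<in> carrier G" for x
      using that by (simp add: carr) blast
    then have "carrier G \<subseteq> Z"
      by (simp add: in_Z subset_iff)
    with ne subset show False
      by blast
  qed
  moreover have "N = {Z} \<or> N = carrier (G Mod Z)" if N: "N \<lhd> G Mod Z" "closedin ?Q N" for N
  proof -
    interpret N: normal N "G Mod Z" by (rule N(1))
    let ?P = "{x \<in> carrier G. ?\<pi> x \<in> N}"
    have "subgroup ?P G"
      using N.m_closed N.one_closed
      by (intro subgroup.intro) (auto simp del: mult_FactGroup simp: one)
    then have "?P \<lhd> G"
      using N.inv_op_closed2 by (auto simp: normal_inv_iff)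
    moreover have "closedin T ?P"
      using closedin_continuous_map_preimage[OF
          quotient_imp_continuous_map[OF quotient_map_coset_topology[OF top]] N(2)]
      by (simp add: top)
    ultimately have "?P = carrier G \<or> ?P \<subseteq> Z"
      using max unfolding proper_closed_normal_def by blast
    then show ?thesis
    proof
      assume "?P = carrier G"
      then have "carrier (G Mod Z) \<subseteq> N"
        by (auto simp: carr)
      then show ?thesis
        using N.subset by blast
    next
      assume "?P \<subseteq> Z"
      have "A = Z" if "A \<in> N" for A
      proof -
        obtain x where "x \<in> carrier G" "A = ?\<pi> x"
          using N.subset \<open>A \<in> N\<close> carr by auto
        with \<open>?P \<subseteq> Z\<close> \<open>A \<in> N\<close> in_Z show ?thesis
          by auto
      qed
      then have "N \<subseteq> {Z}"
        by blast
      then show ?thesis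
        using N.one_closed one by auto
    qed
  qed
  ultimately show ?thesis
    using group_topology_coset_topology[OF gt nZ] by (simp add: topologically_simple_def one)
qed

section \<open>The scalar matrices\<close>

context Z_like_preorder
begin

lemma Z_set_eq: "Z_set r = {a \<in> AU_set r. scalar_imat a}"
proof -
  have "almost_upper_triangular r a" if "scalar_imat a" for a :: "('i, 'b::comm_ring_1) imat"
  proof -
    have "{(i, j). \<not> r i j \<and> a (i, j) \<noteq> 0} = {}"
      using that r_refl unfolding scalar_imat_def by (auto, metis)
    then show ?thesis
      unfolding almost_upper_triangular_def by (metis finite.emptyI)
  qed
  then show ?thesis
    by (auto simp: Z_set_def AU_set_def)
qed

lemma scalar_imatE:
  assumes "scalar_imat a"
  obtains c where "\<And>p q. a (p, q) = (if p = q then c else 0)"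
  using assms unfolding scalar_imat_def by metis

lemma scalar_imat_mult:
  assumes "\<And>p q. a (p, q) = (if p = q then c else 0)"
  shows "imat_mult a x (p, q) = c * x (p, q)" "imat_mult x a (p, q) = x (p, q) * c"
  by (subst imat_mult_eq_sum[of "{p}"]; use assms in auto)
    (subst imat_mult_eq_sum[of "{q}"]; use assms in auto)

lemma Z_set_normal: "(Z_set r :: ('i, 'f::{field, finite}) imat set) \<lhd> AU_group r"
proof -
  interpret G: group "AU_group r :: ('i, 'f) imat monoid"
    by (rule group_AU)
  let ?Z = "Z_set r :: ('i, 'f) imat set"
  have "subgroup ?Z (AU_group r)"
  proof
    show "?Z \<subseteq> carrier (AU_group r)"
      by (auto simp: Z_set_eq)
    show "\<one>\<^bsub>AU_group r\<^esub> \<in> ?Z"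
    proof -
      have "scalar_imat (imat_one :: ('i, 'f) imat)"
        by (auto simp: scalar_imat_def imat_one_def)
      then show ?thesis
        by (simp add: Z_set_eq imat_one_AU)
    qed
    fix a :: "('i, 'f) imat" assume a: "a \<in> ?Z"
    then obtain c where c: "\<And>p q. a (p, q) = (if p = q then c else 0)"
      by (auto simp: Z_set_eq elim: scalar_imatE)
    have aAU: "a \<in> AU_set r"
      using a by (simp add: Z_set_eq)
    have *: "c * (inv\<^bsub>AU_group r\<^esub> a) (p, q) = imat_one (p, q)" for p q
      using scalar_imat_mult(1)[OF c] inv_AU(2)[OF aAU] by metis
    \<comment> \<open>The diagonal entry of \<open>a a^-1 = 1\<close> at an arbitrary index shows
      that \<open>c\<close> is a unit.\<close>
    have "c \<noteq> 0"
      using *[of undefined undefined] by (auto simp: imat_one_def)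
    then have "(inv\<^bsub>AU_group r\<^esub> a) (p, q) = (if p = q then 1 / c else 0)" for p q
      using *[of p q] by (auto simp: imat_one_def field_simps split: if_splits)
    then show "inv\<^bsub>AU_group r\<^esub> a \<in> ?Z"
      using inv_AU(1)[OF aAU] by (auto simp: Z_set_eq scalar_imat_def)
    fix b :: "('i, 'f) imat" assume b: "b \<in> ?Z"
    then show "a \<otimes>\<^bsub>AU_group r\<^esub> b \<in> ?Z"
      using AU_mult[OF aAU, of b] by (auto simp: Z_set_eq scalar_imat_def scalar_imat_mult(1)[OF c])
  qed
  moreover have "x \<otimes>\<^bsub>AU_group r\<^esub> a \<otimes>\<^bsub>AU_group r\<^esub> inv\<^bsub>AU_group r\<^esub> x \<in> ?Z"
    if x: "x \<in> carrier (AU_group r)" and a: "a \<in> ?Z" for x a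
  proof -
    obtain c where c: "\<And>p q. a (p, q) = (if p = q then c else 0)"
      using a by (auto simp: Z_set_eq elim: scalar_imatE)
    have "imat_mult x a = imat_mult a x"
      by (auto simp: fun_eq_iff scalar_imat_mult[OF c])
    then have "x \<otimes>\<^bsub>AU_group r\<^esub> a \<otimes>\<^bsub>AU_group r\<^esub> inv\<^bsub>AU_group r\<^esub> x = a"
      using G.inv_solve_right'[of a "imat_mult x a" x] x a AU_mult by (auto simp: Z_set_eq)
    with a show ?thesis by simp
  qed
  ultimately show ?thesis
    by (simp add: G.normal_inv_iff)
qed

text \<open>Failure to be scalar is visible in at most three entries, and prescribing these gives a
  neighbourhood without scalar matrices.\<close>

lemma Z_set_closed: "closedin (AU_nbhd_topology r) (Z_set r :: ('i, 'r::comm_ring_1) imat set)"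
proof -
  have "\<exists>S. finite S \<and> (\<forall>y\<in>AU_set r. agree_off r S x y \<longrightarrow> y \<in> AU_set r - Z_set r)"
    if x: "x \<in> AU_set r - Z_set r" for x :: "('i, 'r) imat"
  proof -
    have "\<not> scalar_imat x"
      using x by (simp add: Z_set_eq)
    then obtain i j where ij: "i \<noteq> j \<and> x (i, j) \<noteq> 0 \<or> x (i, i) \<noteq> x (j, j)"
      unfolding scalar_imat_def by metis
    have "y \<in> AU_set r - Z_set r" if "y \<in> AU_set r" "agree_off r {(i, j), (i, i), (j, j)} x y" for y
    proof -
      have "y (i, j) = x (i, j)" "y (i, i) = x (i, i)" "y (j, j) = x (j, j)"
        using that(2) by (auto simp: agree_off_def)
      with ij have "\<not> scalar_imat y"
        unfolding scalar_imat_def by metis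
      with that(1) show ?thesis
        by (simp add: Z_set_eq)
    qed
    then show ?thesis
      by (meson finite.emptyI finite.insertI)
  qed
  then have "openin (AU_nbhd_topology r) (AU_set r - Z_set r :: ('i, 'r) imat set)"
    unfolding openin_AU_nbhd_topology by blast
  then show ?thesis
    by (auto simp: closedin_def Z_set_eq)
qed

lemma Z_set_proper:
  assumes "infinite (UNIV :: 'i set)"
  shows "(Z_set r :: ('i, 'f::field) imat set) \<noteq> AU_set r"
proof -
  obtain i :: 'i where "i \<noteq> undefined"
    using ex_new_if_finite[OF assms, of "{undefined}"] by auto
  then have "(elem_mat i undefined 1 :: ('i, 'f) imat) \<in> AU_set r - Z_set r"
    by (auto simp: elem_mat_AU Z_set_eq scalar_imat_def elem_mat_apply)
  then show ?thesis
    by blast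
qed

end

theorem theorem5p2:
  fixes lesim :: "'i \<Rightarrow> 'i \<Rightarrow> bool"
    and G :: "('i, 'f::{field, finite}) imat monoid"
    and T :: "('i, 'f) imat topology"
    and Z :: "('i, 'f) imat set"
  assumes "reflp lesim" and "transp lesim" and "Z_like lesim" and "infinite (UNIV :: 'i set)"
  assumes G: "G = AU_group lesim" and T: "T = AU_topology lesim" and Z: "Z = Z_set lesim"
  shows "proper_closed_normal G T Z
    \<and> (\<forall>N. proper_closed_normal G T N \<longrightarrow> N \<subseteq> Z)
    \<and> topologically_simple (G Mod Z) (coset_topology G T Z)"
proof -
  interpret Z_like_preorder lesim
    using assms(1-3) by unfold_locales
  have T_eq: "T = AU_nbhd_topology lesim"
    unfolding T by (rule AU_topology_eq)
  have proper: "proper_closed_normal G T Z"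
    unfolding proper_closed_normal_def T_eq
    using Z_set_normal Z_set_closed Z_set_proper[OF assms(4)] by (simp add: G Z)
  have largest: "N \<subseteq> Z" if N: "proper_closed_normal G T N" for N
  proof (rule ccontr)
    assume "\<not> N \<subseteq> Z"
    have "N \<lhd> AU_group lesim" "closedin (AU_nbhd_topology lesim) N" "N \<noteq> AU_set lesim"
      using N by (simp_all add: proper_closed_normal_def T_eq G)
    interpret N: AU_normal_subgroup lesim N
      using \<open>N \<lhd> AU_group lesim\<close> assms(4)
      by (intro AU_normal_subgroup.intro AU_normal_subgroup_axioms.intro Z_like_preorder_axioms)
    obtain x where x: "x \<in> N" "\<not> scalar_imat x"
      using \<open>\<not> N \<subseteq> Z\<close> N.N_AU by (auto simp: Z Z_set_eq)
    \<comment> \<open>The nonscalar \<open>x\<close> provides all elementary matrices; with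
      closedness they make \<open>N\<close> the whole group.\<close>
    interpret N: AU_closed_normal_subgroup lesim N
      using \<open>closedin (AU_nbhd_topology lesim) N\<close> N.elem_mat_in_N[OF x]
      by (intro AU_closed_normal_subgroup.intro AU_closed_normal_subgroup_axioms.intro
          N.AU_normal_subgroup_axioms)
    show False
      using N.N_eq_AU \<open>N \<noteq> AU_set lesim\<close> by simp
  qed
  have "group_topology G T"
    unfolding G T_eq by (rule group_topology_AU_nbhd)
  then show ?thesis
    using proper largest topologically_simple_quotient by blast
qed

end
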